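(* Let $H$ be a Hilbert $C^*$-module and $Q\in\mathcal{L}(H)$ a non-projection idempotent such that the matched pair $(m(Q),Q)$ is harmonious. Let $H_1=\mathcal{R}(m(Q))$. Then there exist a positive operator $A\in\mathcal{L}(H_1)$ with $A\ge I_{H_1}$ and a partial isometry $U\in\mathcal{L}(H_1,H_1^\perp)$ with $\mathcal{R}(U^* )=\overline{\mathcal{R}(A-I_{H_1})}$ such that $$U_{m(Q)}QU_{m(Q)}^*=\begin{pmatrix} A & -A^{1/2}(A-I_{H_1})^{1/2}U^*\\ UA^{1/2}(A-I_{H_1})^{1/2} & U(I_{H_1}-A)U^*\end{pmatrix}.$$
   Context: $H$ is a Hilbert module over a $C^*$-algebra, $\mathcal{L}(H)$ the adjointable operators; idempotents satisfy $Q^2=Q$, projections are self-adjoint idempotents. For $T\in\mathcal{L}(H)$, $|T|=(T^*T)^{1/2}$, and $T^\dagger$ is the Moore–Penrose inverse (exists when $\mathcal{R}(T)$ is closed). The matched projection of an idempotent $Q$ is the projection $m(Q)=\tfrac12(|Q^*|+Q^* )|Q^*|^\dagger(|Q^*|+I)^{-1}(|Q^*|+Q)$; the pair $(m(Q),Q)$ is a quasi-projection pair, i.e. $Q^*=(2m(Q)-I)Q(2m(Q)-I)$. A quasi-projection pair $(P,Q)$ is harmonious if $\overline{\mathcal{R}(PQ(I-P))}$ and $\overline{\mathcal{R}((I-P)QP)}$ are orthogonally complemented in $H$. For a projection $P$, $U_P:H\to\mathcal{R}(P)\oplus\mathcal{N}(P)$ is the unitary $h\mapsto(Ph,(I-P)h)^T$;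 here $\mathcal{N}(m(Q))=H_1^\perp$. *)

theory Defs
  imports Complex_Main
begin

record ('h, 'a) hmod =
  hm_scA  :: "complex \<Rightarrow> 'a \<Rightarrow> 'a"
  hm_star :: "'a \<Rightarrow> 'a"
  hm_scH  :: "complex \<Rightarrow> 'h \<Rightarrow> 'h"
  hm_act  :: "'h \<Rightarrow> 'a \<Rightarrow> 'h"
  hm_ip   :: "'h \<Rightarrow> 'h \<Rightarrow> 'a"

definition cstar_alg :: "(complex \<Rightarrow> 'a::{real_normed_algebra,banach} \<Rightarrow> 'a) \<Rightarrow> ('a \<Rightarrow> 'a) \<Rightarrow> bool"
  where "cstar_alg sc st \<longleftrightarrow>
    (\<forall>r x. sc (complex_of_real r) x = scaleR r x) \<and>
    (\<forall>c x y. sc c (x + y) = sc c x + sc c y) \<and>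
    (\<forall>c d x. sc (c + d) x = sc c x + sc d x) \<and>
    (\<forall>c d x. sc (c * d) x = sc c (sc d x)) \<and>
    (\<forall>c x y. sc c (x * y) = sc c x * y \<and> sc c (x * y) = x * sc c y) \<and>
    (\<forall>c x. norm (sc c x) = cmod c * norm x) \<and>
    (\<forall>x. st (st x) = x) \<and>
    (\<forall>x y. st (x + y) = st x + st y) \<and>
    (\<forall>c x. st (sc c x) = sc (cnj c) (st x)) \<and>
    (\<forall>x y. st (x * y) = st y * st x) \<and>
    (\<forall>x. norm (st x * x) = (norm x)\<^sup>2)"

definition positive_el :: "('h, 'a::{real_normed_algebra,banach}) hmod \<Rightarrow> 'a \<Rightarrow> bool"
  where "positive_el H a \<longleftrightarrow> (\<exists>b. a = hm_star H b * b)"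

definition hnorm :: "('h, 'a::{real_normed_algebra,banach}) hmod \<Rightarrow> 'h \<Rightarrow> real"
  where "hnorm H x = sqrt (norm (hm_ip H x x))"

definition hilbert_module :: "('h::ab_group_add, 'a::{real_normed_algebra,banach}) hmod \<Rightarrow> bool"
  where "hilbert_module H \<longleftrightarrow>
    cstar_alg (hm_scA H) (hm_star H) \<and>
    (\<forall>c x y. hm_scH H c (x + y) = hm_scH H c x + hm_scH H c y) \<and>
    (\<forall>c d x. hm_scH H (c + d) x = hm_scH H c x + hm_scH H d x) \<and>
    (\<forall>c d x. hm_scH H (c * d) x = hm_scH H c (hm_scH H d x)) \<and>
    (\<forall>x. hm_scH H 1 x = x) \<and>
    (\<forall>x y a. hm_act H (x + y) a = hm_act H x a + hm_act H y a) \<and>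
    (\<forall>x a b. hm_act H x (a + b) = hm_act H x a + hm_act H x b) \<and>
    (\<forall>x a b. hm_act H x (a * b) = hm_act H (hm_act H x a) b) \<and>
    (\<forall>c x a. hm_scH H c (hm_act H x a) = hm_act H (hm_scH H c x) a) \<and>
    (\<forall>c x a. hm_act H (hm_scH H c x) a = hm_act H x (hm_scA H c a)) \<and>
    (\<forall>x y z. hm_ip H x (y + z) = hm_ip H x y + hm_ip H x z) \<and>
    (\<forall>c x y. hm_ip H x (hm_scH H c y) = hm_scA H c (hm_ip H x y)) \<and>
    (\<forall>x y a. hm_ip H x (hm_act H y a) = hm_ip H x y * a) \<and>
    (\<forall>x y. hm_ip H y x = hm_star H (hm_ip H x y)) \<and>
    (\<forall>x. positive_el H (hm_ip H x x)) \<and>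
    (\<forall>x. hm_ip H x x = 0 \<longrightarrow> x = 0) \<and>
    (\<forall>f :: nat \<Rightarrow> 'h.
       (\<forall>e>0. \<exists>N. \<forall>m\<ge>N. \<forall>n\<ge>N. hnorm H (f m - f n) < e) \<longrightarrow>
       (\<exists>l. \<forall>e>0. \<exists>N. \<forall>n\<ge>N. hnorm H (f n - l) < e))"

definition hclosure :: "('h::ab_group_add, 'a::{real_normed_algebra,banach}) hmod \<Rightarrow> 'h set \<Rightarrow> 'h set"
  where "hclosure H S = {x. \<forall>e>0. \<exists>y\<in>S. hnorm H (x - y) < e}"

definition orth :: "('h::ab_group_add, 'a::{real_normed_algebra,banach}) hmod \<Rightarrow> 'h set \<Rightarrow> 'h set"
  where "orth H M = {z. \<forall>y\<in>M. hm_ip H y z = 0}"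

definition orth_complemented :: "('h::ab_group_add, 'a::{real_normed_algebra,banach}) hmod \<Rightarrow> 'h set \<Rightarrow> bool"
  where "orth_complemented H M \<longleftrightarrow> (\<forall>x. \<exists>y\<in>M. \<exists>z\<in>orth H M. x = y + z)"

text \<open>Adjointable operators from the submodule M to the submodule N (operators are
represented by functions on H; only their values on M matter).  L(H) is the case
M = N = UNIV.\<close>

definition adjointable_between ::
  "('h::ab_group_add, 'a::{real_normed_algebra,banach}) hmod \<Rightarrow> 'h set \<Rightarrow> 'h set \<Rightarrow> ('h \<Rightarrow> 'h) \<Rightarrow> bool"
  where "adjointable_between H M N T \<longleftrightarrow> T ` M \<subseteq> N \<and>
     (\<exists>S. S ` N \<subseteq> M \<and> (\<forall>x\<in>M. \<forall>y\<in>N. hm_ip H (T x) y = hm_ip H x (S y)))"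

definition adjoint_on ::
  "('h::ab_group_add, 'a::{real_normed_algebra,banach}) hmod \<Rightarrow> 'h set \<Rightarrow> 'h set \<Rightarrow> ('h \<Rightarrow> 'h) \<Rightarrow> ('h \<Rightarrow> 'h)"
  where "adjoint_on H M N T = (\<lambda>y. THE z. z \<in> M \<and> (\<forall>x\<in>M. hm_ip H (T x) y = hm_ip H x z))"

definition LH :: "('h::ab_group_add, 'a::{real_normed_algebra,banach}) hmod \<Rightarrow> ('h \<Rightarrow> 'h) set"
  where "LH H = {T. adjointable_between H UNIV UNIV T}"

definition adj :: "('h::ab_group_add, 'a::{real_normed_algebra,banach}) hmod \<Rightarrow> ('h \<Rightarrow> 'h) \<Rightarrow> ('h \<Rightarrow> 'h)"
  where "adj H T = adjoint_on H UNIV UNIV T"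

definition positive_on ::
  "('h::ab_group_add, 'a::{real_normed_algebra,banach}) hmod \<Rightarrow> 'h set \<Rightarrow> ('h \<Rightarrow> 'h) \<Rightarrow> bool"
  where "positive_on H M T \<longleftrightarrow> adjointable_between H M M T \<and>
     (\<exists>B. adjointable_between H M M B \<and> (\<forall>x\<in>M. T x = adjoint_on H M M B (B x)))"

definition sqrt_on ::
  "('h::ab_group_add, 'a::{real_normed_algebra,banach}) hmod \<Rightarrow> 'h set \<Rightarrow> ('h \<Rightarrow> 'h) \<Rightarrow> ('h \<Rightarrow> 'h)"
  where "sqrt_on H M T = (THE S. positive_on H M S \<and> (\<forall>x\<in>M. S (S x) = T x) \<and> (\<forall>x. x \<notin> M \<longrightarrow> S x = 0))"

definition abs_op :: "('h::ab_group_add, 'a::{real_normed_algebra,banach}) hmod \<Rightarrow> ('h \<Rightarrow> 'h) \<Rightarrow> ('h \<Rightarrow> 'h)"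
  where "abs_op H T = sqrt_on H UNIV (adj H T \<circ> T)"

definition mp_inv :: "('h::ab_group_add, 'a::{real_normed_algebra,banach}) hmod \<Rightarrow> ('h \<Rightarrow> 'h) \<Rightarrow> ('h \<Rightarrow> 'h)"
  where "mp_inv H T = (THE X. X \<in> LH H \<and> T \<circ> X \<circ> T = T \<and> X \<circ> T \<circ> X = X \<and>
                              adj H (T \<circ> X) = T \<circ> X \<and> adj H (X \<circ> T) = X \<circ> T)"

definition inv_op :: "('h::ab_group_add, 'a::{real_normed_algebra,banach}) hmod \<Rightarrow> ('h \<Rightarrow> 'h) \<Rightarrow> ('h \<Rightarrow> 'h)"
  where "inv_op H T = (THE S. S \<in> LH H \<and> S \<circ> T = id \<and> T \<circ> S = id)"

definition idempotent :: "('h::ab_group_add, 'a::{real_normed_algebra,banach}) hmod \<Rightarrow> ('h \<Rightarrow> 'h) \<Rightarrow> bool"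
  where "idempotent H Q \<longleftrightarrow> Q \<in> LH H \<and> Q \<circ> Q = Q"

definition projection :: "('h::ab_group_add, 'a::{real_normed_algebra,banach}) hmod \<Rightarrow> ('h \<Rightarrow> 'h) \<Rightarrow> bool"
  where "projection H P \<longleftrightarrow> idempotent H P \<and> adj H P = P"

definition matched_proj :: "('h::ab_group_add, 'a::{real_normed_algebra,banach}) hmod \<Rightarrow> ('h \<Rightarrow> 'h) \<Rightarrow> ('h \<Rightarrow> 'h)"
  where "matched_proj H Q =
    (let Aq = abs_op H (adj H Q); Qs = adj H Q in
     (\<lambda>x. hm_scH H (1/2)
        ((\<lambda>y. Aq y + Qs y)
          (mp_inv H Aq (inv_op H (\<lambda>y. Aq y + y) (Aq x + Q x))))))"

definition quasi_projection_pair :: "('h::ab_group_add, 'a::{real_normed_algebra,banach}) hmod \<Rightarrow> ('h \<Rightarrow> 'h) \<Rightarrow> ('h \<Rightarrow> 'h) \<Rightarrow> bool"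
  where "quasi_projection_pair H P Q \<longleftrightarrow> projection H P \<and> idempotent H Q \<and>
     adj H Q = (\<lambda>y. P y + P y - y) \<circ> Q \<circ> (\<lambda>y. P y + P y - y)"

definition harmonious :: "('h::ab_group_add, 'a::{real_normed_algebra,banach}) hmod \<Rightarrow> ('h \<Rightarrow> 'h) \<Rightarrow> ('h \<Rightarrow> 'h) \<Rightarrow> bool"
  where "harmonious H P Q \<longleftrightarrow> quasi_projection_pair H P Q \<and>
     orth_complemented H (hclosure H (range (\<lambda>x. P (Q (x - P x))))) \<and>
     orth_complemented H (hclosure H (range (\<lambda>x. Q (P x) - P (Q (P x)))))"

definition partial_isometry_on ::
  "('h::ab_group_add, 'a::{real_normed_algebra,banach}) hmod \<Rightarrow> 'h set \<Rightarrow> 'h set \<Rightarrow> ('h \<Rightarrow> 'h) \<Rightarrow> bool"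
  where "partial_isometry_on H M N U \<longleftrightarrow> adjointable_between H M N U \<and>
     (\<forall>x\<in>M. U (adjoint_on H M N U (U x)) = U x)"

end

theory Submission
  imports Defs
begin

text \<open>Adjointable operators on a Hilbert module form a unital \<open>C\<^sup>*\<close>-algebra; positivity is expressed by
  \<open>\<parallel>t - T\<parallel> \<le> t\<close>, which makes the cone closed under sums and yields square roots. Applied first to the
  \<open>C\<^sup>*\<close>-algebra as a module over itself, this gives the Cauchy--Schwarz inequality for every Hilbert module.

  For \<open>P = m(Q)\<close> an explicit computation gives \<open>P Q P \<ge> P\<close> and shows that \<open>Q w = w = Q\<^sup>* w\<close> implies
  \<open>P w = w\<close>. Put \<open>A = P Q P\<close> and \<open>B = (1 - P) Q P\<close>. The quasi-projection identity gives
  \<open>P Q (1 - P) = - B\<^sup>*\<close>, and \<open>Q\<^sup>2 = Q\<close> gives \<open>B\<^sup>* B = A (A - P)\<close>, so that \<open>|B| = A\<^bsup>1/2\<^esup> (A - P)\<^bsup>1/2\<^esup>\<close>.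
  Harmony provides the polar decomposition \<open>B = U |B|\<close>. The lower right corner \<open>d\<close> satisfies
  \<open>d B = B (1 - A)\<close>, which determines it on the closure of the range of \<open>B\<close>; on the complement of that
  closure \<open>Q z\<close> is fixed by \<open>Q\<close> and \<open>Q\<^sup>*\<close> and annihilated by \<open>P\<close>, hence vanishes.\<close>

section \<open>The ring of additive endomorphisms\<close>

text \<open>An inner square is only known to have the form \<open>b\<^sup>* b\<close> in an algebra
  that may lack a unit, and the hard point is that such elements form a cone. Passing to operators
  supplies the unit. Spectra are avoided: square roots come from a norm-convergent iteration, and a
  bound for \<open>X\<close> drawn from one for \<open>X * X + Y * Y\<close> with commuting
  self-adjoint \<open>X\<close>, \<open>Y\<close> replaces spectral arguments. Limits and adjoints
  of operators are controlled through Cauchy--Schwarz, so its proof threatens to be circular. The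
  circle breaks at the algebra itself, where the inequality is submultiplicativity of the norm.
  Harmony is essential for the polar decomposition because closed submodules of a Hilbert module
  need not be complemented. All calculations take place in one ring. The type records additivity
  alone; complex linearity and boundedness follow from adjointability. Since square roots, adjoints
  and inverses are given by definite descriptions, each needs a uniqueness proof.\<close>

typedef (overloaded) 'h endo = "{f :: 'h::ab_group_add \<Rightarrow> 'h. \<forall>x y. f (x + y) = f x + f y}"
  morphisms app Endo
  by (rule exI[of _ id]) simp

notation app (infixr "\<cdot>" 75)

lemma app_Endo: "(\<And>x y. f (x + y) = f x + f y) \<Longrightarrow> Endo f \<cdot> x = f x"
  by (simp add: Endo_inverse)

lemma endo_eqI: "(\<And>x. S \<cdot> x = T \<cdot> x) \<Longrightarrow> S = T"
  by (metis app_inject ext)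

lemma app_add [simp]: "T \<cdot> (x + y) = T \<cdot> x + T \<cdot> y"
  using app[of T] by simp

lemma app_0 [simp]: "T \<cdot> 0 = 0"
  using app_add[of T 0 0] by simp

lemma app_minus [simp]: "T \<cdot> (- x) = - (T \<cdot> x)"
  using app_add[of T x "- x"] by (simp add: eq_neg_iff_add_eq_0 add.commute)

lemma app_diff [simp]: "T \<cdot> (x - y) = T \<cdot> x - T \<cdot> y"
  using app_add[of T x "- y"] by simp

instantiation endo :: (ab_group_add) ring
begin
definition "0 = Endo (\<lambda>x. 0)"
definition "S + T = Endo (\<lambda>x. S \<cdot> x + T \<cdot> x)"
definition "S - T = Endo (\<lambda>x. S \<cdot> x - T \<cdot> x)"
definition "- T = Endo (\<lambda>x. - (T \<cdot> x))"
definition "S * T = Endo (\<lambda>x. S \<cdot> T \<cdot> x)"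

lemma endo_ring_app:
  "(0 :: 'a endo) \<cdot> x = 0" "(S + T) \<cdot> x = S \<cdot> x + T \<cdot> x" "(S - T) \<cdot> x = S \<cdot> x - T \<cdot> x"
  "(- T) \<cdot> x = - (T \<cdot> x)" "(S * T) \<cdot> x = S \<cdot> T \<cdot> x"
  by (simp_all add: zero_endo_def plus_endo_def minus_endo_def uminus_endo_def times_endo_def app_Endo)

instance by standard (rule endo_eqI; simp add: endo_ring_app algebra_simps)+
end

instantiation endo :: (ab_group_add) monoid_mult
begin
definition "1 = Endo (\<lambda>x. x)"

lemma endo_one_app: "(1 :: 'a endo) \<cdot> x = x"
  by (simp add: one_endo_def app_Endo)

instance by standard (rule endo_eqI; simp add: endo_ring_app endo_one_app)+
end

lemmas endo_app [simp] = endo_ring_app endo_one_app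

section \<open>Hilbert modules\<close>

locale hilbert_mod =
  fixes H :: "('h::ab_group_add, 'a::{real_normed_algebra,banach}) hmod"
  assumes hilbert: "hilbert_module H"
begin

abbreviation ip :: "'h \<Rightarrow> 'h \<Rightarrow> 'a" ("\<langle>_,/ _\<rangle>") where "\<langle>x, y\<rangle> \<equiv> hm_ip H x y"
abbreviation sc :: "complex \<Rightarrow> 'h \<Rightarrow> 'h" where "sc \<equiv> hm_scH H"
abbreviation scA :: "complex \<Rightarrow> 'a \<Rightarrow> 'a" where "scA \<equiv> hm_scA H"
abbreviation st :: "'a \<Rightarrow> 'a" where "st \<equiv> hm_star H"
abbreviation act :: "'h \<Rightarrow> 'a \<Rightarrow> 'h" where "act \<equiv> hm_act H"
abbreviation N :: "'h \<Rightarrow> real" where "N \<equiv> hnorm H"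

lemma cstar: "cstar_alg scA st"
  using hilbert unfolding hilbert_module_def by blast

lemma
  shows scA_of_real: "scA (complex_of_real r) a = r *\<^sub>R a"
    and scA_add: "scA c (a + b) = scA c a + scA c b"
    and scA_add_left: "scA (c + d) a = scA c a + scA d a"
    and scA_scA: "scA (c * d) a = scA c (scA d a)"
    and scA_mult_left: "scA c (a * b) = scA c a * b"
    and scA_mult_right: "scA c (a * b) = a * scA c b"
    and norm_scA: "norm (scA c a) = cmod c * norm a"
    and st_st [simp]: "st (st a) = a"
    and st_add: "st (a + b) = st a + st b"
    and st_scA: "st (scA c a) = scA (cnj c) (st a)"
    and st_mult: "st (a * b) = st b * st a"
    and norm_st_mult: "norm (st a * a) = (norm a)\<^sup>2"
  using cstar unfolding cstar_alg_def by (elim conjE; iprover)+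

lemma
  shows sc_add: "sc c (x + y) = sc c x + sc c y"
    and sc_add_left: "sc (c + d) x = sc c x + sc d x"
    and sc_sc: "sc (c * d) x = sc c (sc d x)"
    and sc_1 [simp]: "sc 1 x = x"
    and ip_add_right: "\<langle>x, y + z\<rangle> = \<langle>x, y\<rangle> + \<langle>x, z\<rangle>"
    and ip_sc_right: "\<langle>x, sc c y\<rangle> = scA c \<langle>x, y\<rangle>"
    and ip_act_right: "\<langle>x, act y a\<rangle> = \<langle>x, y\<rangle> * a"
    and ip_st: "\<langle>y, x\<rangle> = st \<langle>x, y\<rangle>"
    and positive_ip: "positive_el H \<langle>x, x\<rangle>"
    and ip_self_eq_0: "\<langle>x, x\<rangle> = 0 \<Longrightarrow> x = 0"
  using hilbert unfolding hilbert_module_def by (elim conjE; iprover)+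

lemma complete:
  fixes f :: "nat \<Rightarrow> 'h"
  assumes "\<And>e. e > 0 \<Longrightarrow> \<exists>k. \<forall>m\<ge>k. \<forall>n\<ge>k. N (f m - f n) < e"
  shows "\<exists>l. \<forall>e>0. \<exists>k. \<forall>n\<ge>k. N (f n - l) < e"
proof -
  have "\<forall>f :: nat \<Rightarrow> 'h. (\<forall>e>0. \<exists>k. \<forall>m\<ge>k. \<forall>n\<ge>k. N (f m - f n) < e) \<longrightarrow> (\<exists>l. \<forall>e>0. \<exists>k. \<forall>n\<ge>k. N (f n - l) < e)"
    using hilbert unfolding hilbert_module_def by (elim conjE) assumption
  then show ?thesis using assms by blast
qed

lemma ip_add_left: "\<langle>x + y, z\<rangle> = \<langle>x, z\<rangle> + \<langle>y, z\<rangle>"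
  by (metis ip_add_right ip_st st_add)

lemma ip_sc_left: "\<langle>sc c x, y\<rangle> = scA (cnj c) \<langle>x, y\<rangle>"
  by (metis ip_sc_right ip_st st_scA)

lemma ip_act_left: "\<langle>act x a, y\<rangle> = st a * \<langle>x, y\<rangle>"
  by (metis ip_act_right ip_st st_mult)

lemma ip_0_right [simp]: "\<langle>x, 0\<rangle> = 0"
  using ip_add_right[of x 0 0] by simp

lemma ip_0_left [simp]: "\<langle>0, x\<rangle> = 0"
  using ip_add_left[of 0 0 x] by simp

lemma ip_minus_right: "\<langle>x, - y\<rangle> = - \<langle>x, y\<rangle>"
  using ip_add_right[of x y "- y"] by (simp add: eq_neg_iff_add_eq_0 add.commute)

lemma ip_minus_left: "\<langle>- x, y\<rangle> = - \<langle>x, y\<rangle>"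
  using ip_add_left[of x "- x" y] by (simp add: eq_neg_iff_add_eq_0 add.commute)

lemma ip_diff_right: "\<langle>x, y - z\<rangle> = \<langle>x, y\<rangle> - \<langle>x, z\<rangle>"
  using ip_add_right[of x y "- z"] by (simp add: ip_minus_right)

lemma ip_diff_left: "\<langle>x - y, z\<rangle> = \<langle>x, z\<rangle> - \<langle>y, z\<rangle>"
  using ip_add_left[of x "- y" z] by (simp add: ip_minus_left)

lemma ip_eqI: "(\<And>z. \<langle>z, x\<rangle> = \<langle>z, y\<rangle>) \<Longrightarrow> x = y"
  using ip_self_eq_0[of "x - y"] by (simp add: ip_diff_right)

lemma ip_eqI_left: "(\<And>z. \<langle>x, z\<rangle> = \<langle>y, z\<rangle>) \<Longrightarrow> x = y"
  using ip_self_eq_0[of "x - y"] by (simp add: ip_diff_left)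

lemma st_0 [simp]: "st 0 = 0"
  using st_add[of 0 0] by simp

lemma norm_st [simp]: "norm (st a) = norm a"
proof -
  have *: "norm b \<le> norm (st b)" for b
  proof -
    have "norm b * norm b \<le> norm (st b) * norm b"
      using norm_mult_ineq[of "st b" b] by (simp add: norm_st_mult power2_eq_square)
    then show ?thesis
      by (cases "norm b = 0") (simp, metis mult_right_le_imp_le norm_ge_zero order_le_less)
  qed
  show ?thesis using *[of a] *[of "st a"] by simp
qed

lemma N_ge_0 [simp]: "0 \<le> N x"
  by (simp add: hnorm_def)

lemma N_sq: "(N x)\<^sup>2 = norm \<langle>x, x\<rangle>"
  by (simp add: hnorm_def)

lemma N_eq_0 [simp]: "N x = 0 \<longleftrightarrow> x = 0"
  using ip_self_eq_0 by (auto simp: hnorm_def)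

lemma N_0 [simp]: "N 0 = 0"
  by simp

lemma N_sc: "N (sc c x) = cmod c * N x"
proof -
  have "norm \<langle>sc c x, sc c x\<rangle> = (cmod c)\<^sup>2 * norm \<langle>x, x\<rangle>"
    by (simp add: ip_sc_left ip_sc_right norm_scA power2_eq_square)
  then show ?thesis by (simp add: hnorm_def real_sqrt_mult)
qed

lemma N_minus [simp]: "N (- x) = N x"
  by (simp add: hnorm_def ip_minus_left ip_minus_right)

lemma N_minus_commute: "N (x - y) = N (y - x)"
  using N_minus[of "x - y"] by simp

subsection \<open>Adjointable operators\<close>

definition is_adj :: "'h endo \<Rightarrow> 'h endo \<Rightarrow> bool"
  where "is_adj T S \<longleftrightarrow> (\<forall>x y. \<langle>T \<cdot> x, y\<rangle> = \<langle>x, S \<cdot> y\<rangle>)"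

definition Lop :: "'h endo set" where "Lop = {T. \<exists>S. is_adj T S}"

definition star :: "'h endo \<Rightarrow> 'h endo" where "star T = (THE S. is_adj T S)"

definition sa :: "'h endo \<Rightarrow> bool" where "sa T \<longleftrightarrow> is_adj T T"

definition scal :: "complex \<Rightarrow> 'h endo" where "scal c = Endo (sc c)"

text \<open>Real scalars become elements of the operator ring, so that scaling and shifts such as
  \<open>rs t - T\<close> are handled by ring rewriting.\<close>

definition rs :: "real \<Rightarrow> 'h endo" where "rs r = scal (complex_of_real r)"

text \<open>A bound in place of the operator norm: no supremum has to be formed, and estimates make
  sense before a map is known to be bounded.\<close>

definition bd :: "'h endo \<Rightarrow> real \<Rightarrow> bool" where "bd T t \<longleftrightarrow> (\<forall>x. N (T \<cdot> x) \<le> t * N x)"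

text \<open>For a self-adjoint operator the second clause confines the spectrum to
  \<open>[0, 2 * t]\<close>. The link with operators \<open>star X * X\<close> is made by
  \<open>pos_sqrt\<close> and \<open>pos_star_mult\<close>.\<close>

definition pos :: "'h endo \<Rightarrow> bool"
  where "pos T \<longleftrightarrow> sa T \<and> (\<exists>t\<ge>0. bd (rs t - T) t)"

lemma scal_app [simp]: "scal c \<cdot> x = sc c x"
  by (simp add: scal_def app_Endo sc_add)

lemma is_adj_unique: "is_adj T S \<Longrightarrow> is_adj T R \<Longrightarrow> S = R"
  unfolding is_adj_def by (metis endo_eqI ip_eqI)

lemma is_adj_star_eq: "is_adj T S \<Longrightarrow> star T = S"
  unfolding star_def using is_adj_unique by blast

lemma is_adj_sym: "is_adj T S \<Longrightarrow> is_adj S T"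
  unfolding is_adj_def by (metis ip_st)

lemma is_adj_Lop: "is_adj T S \<Longrightarrow> T \<in> Lop"
  by (auto simp: Lop_def)

lemma is_adj_star: "T \<in> Lop \<Longrightarrow> is_adj T (star T)"
  using is_adj_star_eq by (auto simp: Lop_def)

lemma star_Lop [simp]: "T \<in> Lop \<Longrightarrow> star T \<in> Lop"
  using is_adj_Lop is_adj_star is_adj_sym by blast

lemma star_star [simp]: "T \<in> Lop \<Longrightarrow> star (star T) = T"
  using is_adj_star is_adj_star_eq is_adj_sym by blast

lemma star_right: "T \<in> Lop \<Longrightarrow> \<langle>T \<cdot> x, y\<rangle> = \<langle>x, star T \<cdot> y\<rangle>"
  using is_adj_star by (auto simp: is_adj_def)

lemma star_left: "T \<in> Lop \<Longrightarrow> \<langle>x, T \<cdot> y\<rangle> = \<langle>star T \<cdot> x, y\<rangle>"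
  using star_right[of "star T"] by simp

lemma sa_iff: "sa T \<longleftrightarrow> T \<in> Lop \<and> star T = T"
  unfolding sa_def using is_adj_Lop is_adj_star is_adj_star_eq by metis

lemma sa_Lop [simp]: "sa T \<Longrightarrow> T \<in> Lop"
  and sa_star [simp]: "sa T \<Longrightarrow> star T = T"
  by (simp_all add: sa_iff)

lemma is_adj_mult: "is_adj T T' \<Longrightarrow> is_adj S S' \<Longrightarrow> is_adj (T * S) (S' * T')"
  by (simp add: is_adj_def)

lemma is_adj_add: "is_adj T T' \<Longrightarrow> is_adj S S' \<Longrightarrow> is_adj (T + S) (T' + S')"
  by (simp add: is_adj_def ip_add_left ip_add_right)

lemma is_adj_diff: "is_adj T T' \<Longrightarrow> is_adj S S' \<Longrightarrow> is_adj (T - S) (T' - S')"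
  by (simp add: is_adj_def ip_diff_left ip_diff_right)

lemma is_adj_minus: "is_adj T T' \<Longrightarrow> is_adj (- T) (- T')"
  by (simp add: is_adj_def ip_minus_left ip_minus_right)

lemma is_adj_1: "is_adj 1 1" and is_adj_0: "is_adj 0 0"
  and is_adj_scal: "is_adj (scal c) (scal (cnj c))"
  by (simp_all add: is_adj_def ip_sc_left ip_sc_right)

lemma
  assumes "T \<in> Lop" "S \<in> Lop"
  shows Lop_mult [simp]: "T * S \<in> Lop" and star_mult [simp]: "star (T * S) = star S * star T"
    and Lop_add [simp]: "T + S \<in> Lop" and star_add [simp]: "star (T + S) = star T + star S"
    and Lop_diff [simp]: "T - S \<in> Lop" and star_diff [simp]: "star (T - S) = star T - star S"
  using assms[THEN is_adj_star] by (blast intro: is_adj_star_eq is_adj_Lop is_adj_mult is_adj_add is_adj_diff)+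

lemma
  assumes "T \<in> Lop"
  shows Lop_minus [simp]: "- T \<in> Lop" and star_minus [simp]: "star (- T) = - star T"
  using assms[THEN is_adj_star] is_adj_minus is_adj_star_eq is_adj_Lop by blast+

lemma Lop_1 [simp]: "1 \<in> Lop" and star_1 [simp]: "star 1 = 1"
  and Lop_0 [simp]: "0 \<in> Lop" and star_0 [simp]: "star 0 = 0"
  and Lop_scal [simp]: "scal c \<in> Lop" and star_scal [simp]: "star (scal c) = scal (cnj c)"
  using is_adj_1 is_adj_0 is_adj_scal is_adj_Lop is_adj_star_eq by blast+

lemma scal_add: "scal (c + d) = scal c + scal d"
  and scal_mult: "scal (c * d) = scal c * scal d"
  and scal_1 [simp]: "scal 1 = 1"
  by (rule endo_eqI; simp add: sc_add_left sc_sc)+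

lemma scal_0 [simp]: "scal 0 = 0"
  using scal_add[of 0 0] by simp

lemma scal_minus: "scal (- c) = - scal c"
  using scal_add[of c "- c"] by (simp add: eq_neg_iff_add_eq_0 add.commute)

lemma scal_diff: "scal (c - d) = scal c - scal d"
  using scal_add[of c "- d"] by (simp add: scal_minus)

lemma app_sc: "T \<in> Lop \<Longrightarrow> T \<cdot> sc c x = sc c (T \<cdot> x)"
  by (rule ip_eqI) (simp add: star_left ip_sc_right)

lemma scal_commute: "T \<in> Lop \<Longrightarrow> T * scal c = scal c * T"
  by (rule endo_eqI) (simp add: app_sc)

lemma scal_left_commute: "T \<in> Lop \<Longrightarrow> T * (scal c * S) = scal c * (T * S)"
  by (simp only: scal_commute flip: mult.assoc)

lemma scal_scal: "scal c * (scal d * T) = scal (c * d) * T"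
  by (simp add: scal_mult mult.assoc)

lemma rs_add: "rs (a + b) = rs a + rs b" and rs_mult: "rs (a * b) = rs a * rs b"
  and rs_diff: "rs (a - b) = rs a - rs b"
  and rs_0 [simp]: "rs 0 = 0" and rs_1 [simp]: "rs 1 = 1"
  and Lop_rs [simp]: "rs a \<in> Lop" and star_rs [simp]: "star (rs a) = rs a"
  and rs_app: "rs a \<cdot> x = sc (complex_of_real a) x"
  by (simp_all add: rs_def scal_add scal_mult scal_diff)

lemma rs_commute: "T \<in> Lop \<Longrightarrow> T * rs a = rs a * T"
  and rs_left_commute: "T \<in> Lop \<Longrightarrow> T * (rs a * S) = rs a * (T * S)"
  and rs_rs: "rs a * (rs b * T) = rs (a * b) * T"
  by (simp_all add: rs_def scal_commute scal_left_commute[of T] scal_scal)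

text \<open>Additivity of both functions is free, since the inner product separates points. This is
  how functions found pointwise, by limits or by choice, enter the ring.\<close>

lemma Lop_of_fun:
  assumes "\<And>x y. \<langle>f x, y\<rangle> = \<langle>x, g y\<rangle>"
  obtains T where "T \<in> Lop" "app T = f" "app (star T) = g"
proof -
  have f: "f (x + y) = f x + f y" for x y
    by (rule ip_eqI_left) (simp add: assms ip_add_left)
  have "\<langle>y, f x\<rangle> = \<langle>g y, x\<rangle>" for x y by (metis assms ip_st)
  then have g: "g (x + y) = g x + g y" for x y
    by (intro ip_eqI_left) (metis ip_add_left)
  have "is_adj (Endo f) (Endo g)"
    using assms by (simp add: is_adj_def app_Endo f g)
  then show ?thesis
    using that[of "Endo f"] is_adj_star_eq is_adj_Lop f g by (auto simp: app_Endo fun_eq_iff)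
qed

lemma star_mult_self_eq_0:
  assumes "T \<in> Lop" "star T * T = 0"
  shows "T = 0"
proof (rule endo_eqI)
  fix x
  have "star T \<cdot> T \<cdot> x = 0"
    using arg_cong[OF assms(2), of "\<lambda>S. S \<cdot> x"] by simp
  then show "T \<cdot> x = 0 \<cdot> x" using assms(1) ip_self_eq_0[of "T \<cdot> x"] by (simp add: star_right)
qed

lemma sa_sq_eq_0: "sa T \<Longrightarrow> T * T = 0 \<Longrightarrow> T = 0"
  using star_mult_self_eq_0[of T] by simp

section \<open>Norm bounds and self-adjoint operators\<close>

lemma bd_mult: "bd T t \<Longrightarrow> bd S s \<Longrightarrow> 0 \<le> t \<Longrightarrow> bd (T * S) (t * s)"
  unfolding bd_def by (simp add: mult.assoc) (meson mult_left_mono order_trans)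

lemma bd_mono: "bd T t \<Longrightarrow> t \<le> s \<Longrightarrow> bd T s"
  unfolding bd_def by (meson N_ge_0 mult_right_mono order_trans)

lemma bd_scal: "bd (scal c) (cmod c)"
  by (simp add: bd_def N_sc)

lemma bd_0: "0 \<le> t \<Longrightarrow> bd 0 t" and bd_1: "bd 1 1"
  by (simp_all add: bd_def)

lemma bd_0_eq: "bd T 0 \<Longrightarrow> T = 0"
  by (rule endo_eqI) (metis N_eq_0 N_ge_0 bd_def endo_app(1) mult_zero_left order_antisym)

lemma bd_rs: "0 \<le> r \<Longrightarrow> bd (rs r) r"
  using bd_scal[of "complex_of_real r"] by (simp add: rs_def)

lemma bd_rs_mult: "0 \<le> r \<Longrightarrow> bd T t \<Longrightarrow> bd (rs r * T) (r * t)"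
  using bd_mult[OF bd_rs] by simp

lemma sa_1 [simp]: "sa 1" and sa_0 [simp]: "sa 0"
  and sa_add: "sa S \<Longrightarrow> sa T \<Longrightarrow> sa (S + T)" and sa_diff: "sa S \<Longrightarrow> sa T \<Longrightarrow> sa (S - T)"
  unfolding sa_def by (simp_all add: is_adj_1 is_adj_0 is_adj_add is_adj_diff)

lemma saI: "T \<in> Lop \<Longrightarrow> star T = T \<Longrightarrow> sa T"
  by (simp only: sa_iff)

lemma sa_rs [simp]: "sa (rs r)"
  by (rule saI) simp_all

lemma sa_rs_mult: "sa T \<Longrightarrow> sa (rs r * T)"
  by (rule saI) (simp_all add: rs_commute[of T])

lemma sa_star_mult: "T \<in> Lop \<Longrightarrow> sa (star T * T)"
  by (rule saI) simp_all

lemma sa_mult: "sa S \<Longrightarrow> sa T \<Longrightarrow> S * T = T * S \<Longrightarrow> sa (S * T)"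
  by (rule saI) simp_all

end

section \<open>Hilbert modules satisfying the Cauchy--Schwarz inequality\<close>

text \<open>The inequality is assumed because the theory built on it is needed twice: for the
  coefficient algebra, where it is immediate, and then for \<open>H\<close>, where its proof uses
  the first instance.\<close>

locale cs_hilbert_mod = hilbert_mod H
  for H :: "('h::ab_group_add, 'a::{real_normed_algebra,banach}) hmod" +
  assumes Cauchy_Schwarz: "norm \<langle>x, y\<rangle> \<le> N x * N y"
begin

lemma N_triangle: "N (x + y) \<le> N x + N y"
proof -
  have "(N (x + y))\<^sup>2 \<le> norm \<langle>x, x\<rangle> + norm \<langle>y, x\<rangle> + (norm \<langle>x, y\<rangle> + norm \<langle>y, y\<rangle>)"
    unfolding N_sq ip_add_left ip_add_right
    by (intro order_trans[OF norm_triangle_ineq] add_mono order_refl order_trans[OF norm_triangle_ineq])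
  also have "\<dots> \<le> (N x)\<^sup>2 + N y * N x + (N x * N y + (N y)\<^sup>2)"
    unfolding N_sq by (intro add_mono Cauchy_Schwarz order_refl)
  also have "\<dots> = (N x + N y)\<^sup>2" by (simp add: power2_eq_square algebra_simps)
  finally show ?thesis by (rule power2_le_imp_le) simp
qed

lemma N_triangle_diff: "N (x - z) \<le> N (x - y) + N (y - z)"
  using N_triangle[of "x - y" "y - z"] by simp

lemma N_diff_le: "N (x - y) \<le> N x + N y"
  using N_triangle[of x "- y"] by simp

lemma bd_add: "bd S s \<Longrightarrow> bd T t \<Longrightarrow> bd (S + T) (s + t)"
  unfolding bd_def endo_app distrib_right by (meson N_triangle add_mono order_trans)

lemma bd_star:
  assumes "T \<in> Lop" "bd T t" "0 \<le> t"
  shows "bd (star T) t"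
  unfolding bd_def
proof
  fix x
  let ?z = "star T \<cdot> x"
  have "N ?z * N ?z = norm \<langle>T \<cdot> ?z, x\<rangle>"
    using assms(1) by (simp add: star_right N_sq flip: power2_eq_square)
  also have "\<dots> \<le> N (T \<cdot> ?z) * N x" by (rule Cauchy_Schwarz)
  also have "\<dots> \<le> t * N ?z * N x" using assms(2) by (auto simp: bd_def intro: mult_right_mono)
  finally have "N ?z * N ?z \<le> N ?z * (t * N x)" by (simp add: algebra_simps)
  then show "N ?z \<le> t * N x"
    using assms(3) N_ge_0[of ?z] N_ge_0[of x] by (cases "N ?z = 0") (auto simp del: N_ge_0 N_eq_0)
qed

lemma bd_star_mult:
  assumes "T \<in> Lop" "bd (star T * T) (t\<^sup>2)" "0 \<le> t"
  shows "bd T t"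
  unfolding bd_def
proof
  fix x
  have "(N (T \<cdot> x))\<^sup>2 = norm \<langle>x, (star T * T) \<cdot> x\<rangle>"
    using assms(1) by (simp add: star_right N_sq)
  also have "\<dots> \<le> N x * N ((star T * T) \<cdot> x)" by (rule Cauchy_Schwarz)
  also have "\<dots> \<le> N x * (t\<^sup>2 * N x)"
    using assms(2) unfolding bd_def by (intro mult_left_mono) auto
  also have "\<dots> = (t * N x)\<^sup>2" by (simp add: power2_eq_square algebra_simps)
  finally show "N (T \<cdot> x) \<le> t * N x" by (rule power2_le_imp_le) (simp add: assms(3))
qed

subsection \<open>Convergence\<close>

text \<open>The type \<open>'h\<close> carries no topology of its own, so convergence is reduced to
  that of real sequences.\<close>

definition conv :: "(nat \<Rightarrow> 'h) \<Rightarrow> 'h \<Rightarrow> bool"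
  where "conv f l \<longleftrightarrow> (\<lambda>n. N (f n - l)) \<longlonglongrightarrow> 0"

lemma convI:
  assumes "\<And>n. N (f n - l) \<le> a n" "a \<longlonglongrightarrow> 0"
  shows "conv f l"
  unfolding conv_def by (rule tendsto_sandwich[OF _ _ tendsto_const assms(2)]) (auto simp: assms(1))

lemma conv_ip:
  assumes "conv f l" "conv g m"
  shows "(\<lambda>n. \<langle>f n, g n\<rangle>) \<longlonglongrightarrow> \<langle>l, m\<rangle>"
proof -
  have b: "norm (\<langle>f n, g n\<rangle> - \<langle>l, m\<rangle>) \<le> N (f n - l) * (N m + N (g n - m)) + N l * N (g n - m)" for n
  proof -
    have "\<langle>f n, g n\<rangle> - \<langle>l, m\<rangle> = \<langle>f n - l, g n\<rangle> + \<langle>l, g n - m\<rangle>"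
      by (simp add: ip_diff_left ip_diff_right)
    then have "norm (\<langle>f n, g n\<rangle> - \<langle>l, m\<rangle>) \<le> norm \<langle>f n - l, g n\<rangle> + norm \<langle>l, g n - m\<rangle>"
      by (simp only: norm_triangle_ineq)
    also have "\<dots> \<le> N (f n - l) * N (g n) + N l * N (g n - m)"
      by (intro add_mono Cauchy_Schwarz)
    also have "N (g n) \<le> N m + N (g n - m)" using N_triangle[of m "g n - m"] by simp
    finally show ?thesis by (simp add: mult_left_mono)
  qed
  let ?h = "\<lambda>n. N (f n - l) * (N m + N (g n - m)) + N l * N (g n - m)"
  have "?h \<longlonglongrightarrow> 0 * (N m + 0) + N l * 0"
    using assms unfolding conv_def by (intro tendsto_intros)
  then have "?h \<longlonglongrightarrow> 0" by simp
  from tendsto_sandwich[OF _ _ tendsto_const this] b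
  have "(\<lambda>n. norm (\<langle>f n, g n\<rangle> - \<langle>l, m\<rangle>)) \<longlonglongrightarrow> 0"
    by (simp only: norm_ge_zero eventually_True)
  then show ?thesis by (rule LIM_zero_cancel[OF tendsto_norm_zero_cancel])
qed

lemma conv_const: "conv (\<lambda>n. l) l"
  by (simp add: conv_def)

lemma conv_Suc: "conv f l \<Longrightarrow> conv (\<lambda>n. f (Suc n)) l"
  unfolding conv_def by (rule LIMSEQ_Suc)

text \<open>Completeness applied to the partial sums of a dominated series. The explicit tail
  estimate is what the gliding hump argument consumes.\<close>

lemma series_conv:
  assumes s: "summable a" and a: "\<And>n. N (f (Suc n) - f n) \<le> a n"
  obtains l where "conv f l" "\<And>n. N (f n - l) \<le> (\<Sum>k. a (k + n))"
proof -
  define r where "r n = (\<Sum>k. a (k + n))" for n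
  have a0: "0 \<le> a n" for n using a[of n] N_ge_0 order_trans by blast
  have fin: "N (f (n + k) - f n) \<le> (\<Sum>i<k. a (i + n))" for n k
  proof (induction k)
    case (Suc k)
    have "N (f (n + Suc k) - f n) \<le> N (f (Suc (n + k)) - f (n + k)) + N (f (n + k) - f n)"
      using N_triangle_diff[of "f (n + Suc k)" "f n" "f (n + k)"] by simp
    then show ?case using Suc a[of "n + k"] by (simp add: add.commute)
  qed simp
  have le: "N (f (n + k) - f n) \<le> r n" for n k
    using fin[of n k] sum_le_suminf[of "\<lambda>i. a (i + n)" "{..<k}"] s a0
    by (fastforce simp: r_def summable_iff_shift)
  have r0: "r \<longlonglongrightarrow> 0"
    using suminf_exist_split[OF _ s] by (intro LIMSEQ_I) (simp add: r_def)
  have "\<exists>l. \<forall>e>0. \<exists>k. \<forall>n\<ge>k. N (f n - l) < e"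
  proof (rule complete)
    fix e :: real assume "e > 0"
    then obtain k where k: "r k < e / 2"
      using order_tendstoD(2)[OF r0, of "e / 2"] by (auto simp: eventually_sequentially)
    have "N (f m - f n) < e" if "m \<ge> k" "n \<ge> k" for m n
      using N_triangle_diff[of "f m" "f n" "f k"] le[of k "m - k"] le[of k "n - k"] that k
      by (simp add: N_minus_commute[of "f k" "f n"])
    then show "\<exists>k. \<forall>m\<ge>k. \<forall>n\<ge>k. N (f m - f n) < e" by blast
  qed
  then obtain l where l: "\<And>e. e > 0 \<Longrightarrow> \<exists>k. \<forall>n\<ge>k. N (f n - l) < e" by blast
  have le': "N (f n - l) \<le> r n" for n
  proof (rule field_le_epsilon)
    fix e :: real assume "e > 0"
    then obtain k where "\<forall>n\<ge>k. N (f n - l) < e" using l by blast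
    then have "N (f (n + k) - l) < e" by simp
    then show "N (f n - l) \<le> r n + e"
      using N_triangle_diff[of "f n" l "f (n + k)"] le[of n k] by (simp add: N_minus_commute[of "f n"])
  qed
  show ?thesis
    using that[of l] convI[OF le' r0] le' by (simp add: r_def)
qed

text \<open>By \<open>bd_star\<close> the adjoints satisfy the same increment bounds, so they
  converge pointwise too, and the two limits are adjoint by continuity of the inner product.\<close>

lemma Lop_limit:
  assumes Y: "\<And>n. Y n \<in> Lop" and bd: "\<And>n. bd (Y (Suc n) - Y n) (a n)"
    and s: "summable a" and a0: "\<And>n. 0 \<le> a n"
  shows "\<exists>Z\<in>Lop. \<forall>x. conv (\<lambda>n. Y n \<cdot> x) (Z \<cdot> x)"
proof -
  have conv: "\<exists>l. conv (\<lambda>n. X n \<cdot> x) l" if "\<And>n. bd (X (Suc n) - X n) (a n)" for X x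
    using series_conv[OF summable_mult2[OF s, of "N x"], of "\<lambda>n. X n \<cdot> x"] that
    unfolding bd_def by (metis endo_app(3))
  have bd': "bd (star (Y (Suc n)) - star (Y n)) (a n)" for n
    using bd_star[OF _ bd a0, of n] Y by simp
  obtain f g where f: "\<And>x. conv (\<lambda>n. Y n \<cdot> x) (f x)" and g: "\<And>x. conv (\<lambda>n. star (Y n) \<cdot> x) (g x)"
    using conv[of Y, OF bd] conv[of "\<lambda>n. star (Y n)", OF bd'] by metis
  have "\<langle>f x, y\<rangle> = \<langle>x, g y\<rangle>" for x y
  proof (rule LIMSEQ_unique)
    show "(\<lambda>n. \<langle>Y n \<cdot> x, y\<rangle>) \<longlonglongrightarrow> \<langle>f x, y\<rangle>" by (rule conv_ip[OF f conv_const])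
    show "(\<lambda>n. \<langle>Y n \<cdot> x, y\<rangle>) \<longlonglongrightarrow> \<langle>x, g y\<rangle>"
      using conv_ip[OF conv_const g, of x y] Y by (simp add: star_right)
  qed
  then obtain Z where "Z \<in> Lop" "app Z = f" "app (star Z) = g" by (rule Lop_of_fun)
  then show ?thesis using f by (intro bexI[of _ Z]) auto
qed

lemma bd_limit:
  assumes "\<And>n. bd (Y n) t" "conv (\<lambda>n. Y n \<cdot> x) z"
  shows "N z \<le> t * N x"
proof -
  have "(\<lambda>n. N (Y n \<cdot> x - z) + t * N x) \<longlonglongrightarrow> 0 + t * N x"
    using assms(2) unfolding conv_def by (intro tendsto_intros)
  moreover have "N z \<le> N (Y n \<cdot> x - z) + t * N x" for n
    using N_diff_le[of "Y n \<cdot> x" "Y n \<cdot> x - z"] assms(1)[of n] by (simp add: bd_def) (smt (verit))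
  ultimately show ?thesis using LIMSEQ_le_const by fastforce
qed

lemma commute_limit:
  assumes "\<And>n. C * Y n = Y n * C" "C \<in> Lop" "\<And>n x. conv (\<lambda>n. Y n \<cdot> x) (Z \<cdot> x)"
  shows "C * Z = Z * C"
proof (rule endo_eqI, rule ip_eqI_left)
  fix x y
  have "(\<lambda>n. \<langle>Y n \<cdot> x, star C \<cdot> y\<rangle>) \<longlonglongrightarrow> \<langle>Z \<cdot> x, star C \<cdot> y\<rangle>"
    by (rule conv_ip[OF assms(3) conv_const])
  moreover have "\<langle>Y n \<cdot> x, star C \<cdot> y\<rangle> = \<langle>Y n \<cdot> C \<cdot> x, y\<rangle>" for n
    using star_right[OF assms(2), of "Y n \<cdot> x" y] arg_cong[OF assms(1)[of n], of "\<lambda>T. T \<cdot> x"] by simp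
  moreover have "(\<lambda>n. \<langle>Y n \<cdot> C \<cdot> x, y\<rangle>) \<longlonglongrightarrow> \<langle>Z \<cdot> C \<cdot> x, y\<rangle>"
    by (rule conv_ip[OF assms(3) conv_const])
  ultimately have "\<langle>Z \<cdot> x, star C \<cdot> y\<rangle> = \<langle>Z \<cdot> C \<cdot> x, y\<rangle>" using LIMSEQ_unique by simp
  then show "\<langle>(C * Z) \<cdot> x, y\<rangle> = \<langle>(Z * C) \<cdot> x, y\<rangle>" by (simp add: star_right[OF assms(2)])
qed

text \<open>A gliding hump argument: if \<open>N (T \<cdot> u n)\<close> grows fast while \<open>N (u n) \<le> 1\<close>, then a suitable
  sum \<open>x\<close> of multiples of the \<open>T \<cdot> u n\<close> makes \<open>\<langle>T \<cdot> u n, x\<rangle> = \<langle>u n, star T \<cdot> x\<rangle>\<close> unbounded.\<close>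

lemma Lop_bounded:
  assumes T: "T \<in> Lop"
  obtains t where "0 < t" "bd T t"
proof (rule ccontr)
  assume "\<not> thesis"
  with that have nb: "\<And>t. 0 < t \<Longrightarrow> \<not> bd T t" by blast
  \<comment> \<open>Of this factor, \<open>3 ^ n\<close> is used up by the weights of the series,
    \<open>2\<close> by the half lost to its tail, and \<open>1 + real n\<close> survives as an
    unbounded lower bound.\<close>
  have "\<exists>u. N u \<le> 1 \<and> N (T \<cdot> u) \<ge> 2 * (1 + real n) * 3 ^ n" for n
  proof -
    let ?K = "2 * (1 + real n) * 3 ^ n"
    obtain x where x: "N (T \<cdot> x) > ?K * N x" using nb[of ?K] by (auto simp: bd_def not_le)
    have "N x \<noteq> 0" using x by auto
    then have Nx: "N x > 0" using N_ge_0[of x] by linarith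
    let ?c = "complex_of_real (1 / N x)"
    have "N (sc ?c x) = 1" "N (T \<cdot> sc ?c x) = N (T \<cdot> x) / N x"
      using Nx T by (auto simp: N_sc app_sc norm_divide)
    then show ?thesis using x Nx by (intro exI[of _ "sc ?c x"]) (simp add: pos_le_divide_eq)
  qed
  then obtain u where u: "\<And>n. N (u n) \<le> 1" "\<And>n. N (T \<cdot> u n) \<ge> 2 * (1 + real n) * 3 ^ n"
    by metis
  define v where "v n = T \<cdot> u n" for n
  define w where "w n = sc (complex_of_real (1 / (3 ^ n * N (v n)))) (v n)" for n
  have vpos: "N (v n) > 0" for n
    using u(2)[of n] by (simp add: v_def) (smt (verit) mult_pos_pos zero_less_power of_nat_0_le_iff)
  have Nw: "N (w n) = 1 / 3 ^ n" for n
    using vpos[of n] by (auto simp: w_def N_sc norm_divide norm_mult norm_power)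
  have vw: "norm \<langle>v n, w n\<rangle> = N (v n) / 3 ^ n" for n
    using vpos[of n] by (auto simp: w_def ip_sc_right norm_scA N_sq[symmetric] power2_eq_square norm_divide norm_mult norm_power)
  \<comment> \<open>The inner products of \<open>f n + w n\<close> and \<open>f n - w n\<close> with
    \<open>v n\<close> differ by twice \<open>\<langle>v n, w n\<rangle>\<close>, so one of them has
    at least the norm of \<open>\<langle>v n, w n\<rangle>\<close>; the sign is chosen
    accordingly.\<close>
  define f where "f = rec_nat (0 :: 'h) (\<lambda>n x. if norm \<langle>v n, x + w n\<rangle> \<ge> N (v n) / 3 ^ n then x + w n else x - w n)"
  have fS: "f (Suc n) = (if norm \<langle>v n, f n + w n\<rangle> \<ge> N (v n) / 3 ^ n then f n + w n else f n - w n)" for n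
    by (simp add: f_def)
  have big: "norm \<langle>v n, f (Suc n)\<rangle> \<ge> N (v n) / 3 ^ n" for n
  proof (cases "norm \<langle>v n, f n + w n\<rangle> \<ge> N (v n) / 3 ^ n")
    case False
    have "2 * norm \<langle>v n, w n\<rangle> = norm (\<langle>v n, f n + w n\<rangle> - \<langle>v n, f n - w n\<rangle>)"
      by (simp add: ip_add_right ip_diff_right flip: scaleR_2)
    also have "\<dots> \<le> norm \<langle>v n, f n + w n\<rangle> + norm \<langle>v n, f n - w n\<rangle>"
      by (rule norm_triangle_ineq4)
    finally show ?thesis using False vw[of n] by (simp add: fS)
  qed (simp add: fS)
  have "summable (\<lambda>n. (1 / 3 :: real) ^ n)" by (rule summable_geometric) simp
  then have sum: "summable (\<lambda>n. 1 / 3 ^ n :: real)" by (simp add: power_one_over)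
  have "N (f (Suc n) - f n) \<le> 1 / 3 ^ n" for n
    by (simp add: fS Nw)
  then obtain x where x: "\<And>n. N (f n - x) \<le> (\<Sum>k. 1 / 3 ^ (k + n))"
    using series_conv[OF sum] by blast
  \<comment> \<open>All later terms together spoil at most half of the lower bound
    \<open>big\<close>. This is why the weights decay with ratio 1/3; ratio 1/2 would leave
    nothing.\<close>
  have tail: "(\<Sum>k. 1 / 3 ^ (k + Suc n) :: real) = 1 / 2 / 3 ^ n" for n
  proof -
    have "(\<lambda>k. (1 / 3 :: real) ^ k * (1 / 3 ^ Suc n)) sums (1 / (1 - 1 / 3) * (1 / 3 ^ Suc n))"
      by (intro sums_mult2 geometric_sums) simp
    then show ?thesis by (auto simp: sums_iff power_add power_one_over field_simps)
  qed
  have "1 + real n \<le> N (star T \<cdot> x)" for n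
  proof -
    have "norm \<langle>v n, f (Suc n) - x\<rangle> \<le> N (v n) * (1 / 2 / 3 ^ n)"
      using x[of "Suc n"] unfolding tail by (intro order_trans[OF Cauchy_Schwarz] mult_left_mono N_ge_0)
    moreover have "norm \<langle>v n, f (Suc n)\<rangle> \<le> norm \<langle>v n, f (Suc n) - x\<rangle> + norm \<langle>v n, x\<rangle>"
      using norm_triangle_ineq[of "\<langle>v n, f (Suc n) - x\<rangle>" "\<langle>v n, x\<rangle>"] by (simp add: ip_diff_right)
    moreover have "norm \<langle>v n, x\<rangle> \<le> N (star T \<cdot> x)"
      using Cauchy_Schwarz[of "u n" "star T \<cdot> x"] mult_right_mono[OF u(1)[of n] N_ge_0[of "star T \<cdot> x"]]
      by (simp add: v_def star_right[OF T])
    ultimately have "N (v n) / 3 ^ n \<le> N (v n) / 3 ^ n / 2 + N (star T \<cdot> x)"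
      using big[of n] by simp
    moreover have "N (v n) / 3 ^ n \<ge> 2 * (1 + real n)"
      using u(2)[of n] by (simp add: v_def pos_le_divide_eq)
    moreover have "m \<le> s" if "q \<le> q / 2 + s" "2 * m \<le> q" for m q s :: real
      using that by linarith
    ultimately show ?thesis by blast
  qed
  moreover obtain n where "N (star T \<cdot> x) < real n" using reals_Archimedean2 by blast
  ultimately show False by (smt (verit))
qed

subsection \<open>Square roots\<close>

lemma half_double: "rs (1/2) * (T + T) = T"
proof -
  have "rs (1/2) + rs (1/2) = 1" using rs_add[of "1/2" "1/2"] by simp
  then show ?thesis by (metis distrib_left distrib_right mult_1_left)
qed

text \<open>The iteration \<open>Y' = (T + Y\<^sup>2) / 2\<close>, dominated term by term by the same scalar
  iteration at \<open>T = 1\<close>, converges to \<open>1 - sqrt (1 - T)\<close>.\<close>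

lemma sqrt_one_minus:
  assumes T: "sa T" "bd T 1"
  obtains Y where "sa Y" "bd Y 1" "(1 - Y) * (1 - Y) = 1 - T"
    "\<And>C. C \<in> Lop \<Longrightarrow> C * T = T * C \<Longrightarrow> C * Y = Y * C"
proof -
  let ?h = "rs (1/2)"
  define Y where "Y = rec_nat 0 (\<lambda>n y. ?h * (T + y * y))"
  define y where "y = rec_nat (0::real) (\<lambda>n y. (1 + y * y) / 2)"
  have Y0: "Y 0 = 0" and YS: "Y (Suc n) = ?h * (T + Y n * Y n)" for n
    by (simp_all add: Y_def)
  have y0: "y 0 = 0" and yS: "y (Suc n) = (1 + y n * y n) / 2" for n
    by (simp_all add: y_def)
  have y_range: "0 \<le> y n \<and> y n \<le> 1" for n
  proof (induction n)
    case (Suc n)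
    then have "y n * y n \<le> 1" by (intro mult_le_one) auto
    then show ?case by (simp add: yS)
  qed (simp add: y0)
  have y_step: "y (Suc (Suc n)) - y (Suc n) = 1/2 * ((y (Suc n) + y n) * (y (Suc n) - y n))" for n
    by (simp add: yS field_simps)
  have y_mono: "0 \<le> y (Suc n) - y n" for n
  proof (induction n)
    case (Suc n) then show ?case unfolding y_step using y_range[of n] y_range[of "Suc n"] by simp
  qed (simp add: yS y0)
  have Ysa: "sa (Y n)" for n
    by (induction n) (auto simp: Y0 YS intro!: sa_rs_mult sa_add sa_mult T)
  have Ycomm: "C * Y n = Y n * C" if "C \<in> Lop" "C * T = T * C" for C n
  proof (induction n)
    case (Suc n)
    have "C * (Y n * Y n) = Y n * Y n * C" using Suc by (metis mult.assoc)
    then have "C * (T + Y n * Y n) = (T + Y n * Y n) * C" using that(2) by (simp add: algebra_simps)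
    then show ?case using rs_left_commute[OF that(1)] by (simp add: YS mult.assoc)
  qed (simp add: Y0)
  have YT: "Y n * T = T * Y n" for n using Ycomm[of T n] T by simp
  have YY: "Y m * Y n = Y n * Y m" for m n using Ycomm[of "Y m" n] Ysa YT by simp
  have bdY: "bd (Y n) (y n)" for n
  proof (induction n)
    case (Suc n)
    have "bd (?h * (T + Y n * Y n)) (1/2 * (1 + y n * y n))"
      by (intro bd_rs_mult bd_add bd_mult T Suc) (simp_all add: y_range)
    then show ?case by (simp add: YS yS)
  qed (simp add: Y0 y0 bd_0)
  have Ystep: "Y (Suc (Suc n)) - Y (Suc n) = ?h * ((Y (Suc n) + Y n) * (Y (Suc n) - Y n))" for n
  proof -
    have "(Y (Suc n) + Y n) * (Y (Suc n) - Y n) = (T + Y (Suc n) * Y (Suc n)) - (T + Y n * Y n)"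
      using YY[of n "Suc n"] by (simp add: algebra_simps)
    then show ?thesis by (simp only: YS[of "Suc n"] YS[of n] right_diff_distrib)
  qed
  \<comment> \<open>Every factor of the increment is dominated by its scalar counterpart. The scalar
    increments are summable by telescoping, because \<open>y\<close> is monotone and
    bounded.\<close>
  have bdd: "bd (Y (Suc n) - Y n) (y (Suc n) - y n)" for n
  proof (induction n)
    case 0
    then show ?case using bd_rs_mult[OF _ T(2), of "1/2"] by (simp add: Y0 YS y0 yS)
  next
    case (Suc n)
    show ?case unfolding Ystep y_step
      by (intro bd_rs_mult bd_mult bd_add bdY Suc) (simp_all add: y_range)
  qed
  have "incseq y" using y_mono by (intro incseq_SucI) simp
  then have "convergent y"
    using y_range by (intro Bseq_mono_convergent BseqI'[of _ 1]) (auto simp: incseq_def)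
  then have "summable (\<lambda>n. y (Suc n) - y n)"
    using telescope_summable by (auto simp: convergent_def)
  then obtain Z where Z: "Z \<in> Lop" "\<And>x. conv (\<lambda>n. Y n \<cdot> x) (Z \<cdot> x)"
    using Lop_limit[of Y, OF sa_Lop[OF Ysa] bdd _ y_mono] by blast
  have adj: "\<langle>Z \<cdot> x, z\<rangle> = \<langle>x, Z \<cdot> z\<rangle>" for x z
  proof (rule LIMSEQ_unique)
    show "(\<lambda>n. \<langle>Y n \<cdot> x, z\<rangle>) \<longlonglongrightarrow> \<langle>Z \<cdot> x, z\<rangle>" by (rule conv_ip[OF Z(2) conv_const])
    show "(\<lambda>n. \<langle>Y n \<cdot> x, z\<rangle>) \<longlonglongrightarrow> \<langle>x, Z \<cdot> z\<rangle>"
      using conv_ip[OF conv_const Z(2), of x z] Ysa by (simp add: star_right)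
  qed
  have saZ: "sa Z" using adj by (simp add: sa_def is_adj_def)
  have bdZ: "bd Z 1"
    unfolding bd_def using bd_limit[OF _ Z(2)] bd_mono[OF bdY] y_range by blast
  have fix_eq: "Z + Z = T + Z * Z"
  proof (rule endo_eqI, rule ip_eqI_left)
    fix x z
    have 1: "(\<lambda>n. \<langle>Y (Suc n) \<cdot> x, z\<rangle> + \<langle>Y (Suc n) \<cdot> x, z\<rangle>) \<longlonglongrightarrow> \<langle>Z \<cdot> x, z\<rangle> + \<langle>Z \<cdot> x, z\<rangle>"
      by (intro tendsto_add conv_ip conv_Suc[OF Z(2)] conv_const)
    have "Y (Suc n) + Y (Suc n) = T + Y n * Y n" for n
      unfolding YS by (metis distrib_left half_double)
    then have "\<langle>Y (Suc n) \<cdot> x, z\<rangle> + \<langle>Y (Suc n) \<cdot> x, z\<rangle> = \<langle>T \<cdot> x, z\<rangle> + \<langle>Y n \<cdot> x, Y n \<cdot> z\<rangle>" for n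
      using Ysa[of n] by (simp add: star_left flip: ip_add_left endo_app)
    then have 2: "(\<lambda>n. \<langle>Y (Suc n) \<cdot> x, z\<rangle> + \<langle>Y (Suc n) \<cdot> x, z\<rangle>) \<longlonglongrightarrow> \<langle>T \<cdot> x, z\<rangle> + \<langle>Z \<cdot> x, Z \<cdot> z\<rangle>"
      by (simp, intro tendsto_intros conv_ip Z(2))
    show "\<langle>(Z + Z) \<cdot> x, z\<rangle> = \<langle>(T + Z * Z) \<cdot> x, z\<rangle>"
      using LIMSEQ_unique[OF 1 2] saZ by (simp add: ip_add_left star_left)
  qed
  have "C * Z = Z * C" if "C \<in> Lop" "C * T = T * C" for C
    using commute_limit[OF Ycomm[OF that] that(1) Z(2)] .
  moreover have "(1 - Z) * (1 - Z) = 1 - T"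
    using fix_eq by (simp add: algebra_simps)
  ultimately show ?thesis using that saZ bdZ by blast
qed

section \<open>Closure properties of the positive cone\<close>

lemma posI: "sa T \<Longrightarrow> 0 \<le> t \<Longrightarrow> bd (rs t - T) t \<Longrightarrow> pos T"
  by (auto simp: pos_def)

lemma pos_sa [simp]: "pos T \<Longrightarrow> sa T"
  by (simp add: pos_def)

lemma pos_Lop [simp]: "pos T \<Longrightarrow> T \<in> Lop"
  by simp

lemma pos_add:
  assumes "pos S" "pos T"
  shows "pos (S + T)"
proof -
  obtain s t where "0 \<le> s" "bd (rs s - S) s" "0 \<le> t" "bd (rs t - T) t"
    using assms by (auto simp: pos_def)
  then have "bd (rs (s + t) - (S + T)) (s + t)"
    using bd_add[of "rs s - S" s "rs t - T" t] by (simp add: rs_add algebra_simps)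
  then show ?thesis using assms \<open>0 \<le> s\<close> \<open>0 \<le> t\<close> by (intro posI[of _ "s + t"] sa_add) auto
qed

lemma pos_rs_minus: "sa T \<Longrightarrow> bd T t \<Longrightarrow> 0 \<le> t \<Longrightarrow> pos (rs t - T)"
  by (rule posI[of _ t]) (auto intro: sa_diff)

lemma pos_rs: "0 \<le> t \<Longrightarrow> pos (rs t)"
  using pos_rs_minus[of 0 t] by (simp add: bd_0)

lemma pos_0: "pos 0"
  using pos_rs[of 0] by simp

lemma pos_scale:
  assumes "pos T" "0 \<le> r"
  shows "pos (rs r * T)"
proof -
  obtain t where t: "0 \<le> t" "bd (rs t - T) t" using assms by (auto simp: pos_def)
  have "rs (r * t) - rs r * T = rs r * (rs t - T)" by (simp add: rs_mult algebra_simps)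
  then have "bd (rs (r * t) - rs r * T) (r * t)" using bd_rs_mult[OF assms(2) t(2)] by simp
  then show ?thesis using assms t by (intro posI[of _ "r * t"] sa_rs_mult) auto
qed

text \<open>The operator \<open>V = 1 - T / t\<close> has bound 1, so \<open>sqrt_one_minus\<close>
  yields \<open>Y\<close> with \<open>(1 - Y)\<^sup>2 = T / t\<close>, and the bound 1 on
  \<open>Y\<close> makes \<open>1 - Y\<close> positive. The commutation clause stands in for the
  root being a limit of polynomials in \<open>T\<close>.\<close>

lemma pos_sqrt:
  assumes "pos T"
  obtains S where "pos S" "S * S = T" "\<And>C. C \<in> Lop \<Longrightarrow> C * T = T * C \<Longrightarrow> C * S = S * C"
proof -
  obtain t where t: "0 \<le> t" "bd (rs t - T) t" using assms by (auto simp: pos_def)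
  show ?thesis
  proof (cases "t = 0")
    case True
    then have "T = 0" using t bd_0_eq by fastforce
    then show ?thesis using that[of 0] pos_0 by simp
  next
    case False
    with t have t0: "t > 0" by simp
    define V where "V = 1 - rs (1 / t) * T"
    have V: "V = rs (1 / t) * (rs t - T)"
      using t0 rs_mult[of "1 / t" t] by (simp add: V_def algebra_simps)
    have saV: "sa V" unfolding V_def using assms by (intro sa_diff sa_rs_mult) auto
    have "bd V (1 / t * t)" unfolding V using t t0 by (intro bd_rs_mult) auto
    then have "bd V 1" using t0 by simp
    then obtain Y where Y: "sa Y" "bd Y 1" "(1 - Y) * (1 - Y) = 1 - V"
      "\<And>C. C \<in> Lop \<Longrightarrow> C * V = V * C \<Longrightarrow> C * Y = Y * C"
      using sqrt_one_minus[OF saV] by blast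
    define S where "S = rs (sqrt t) * (1 - Y)"
    have "pos (1 - Y)" using pos_rs_minus[OF Y(1,2)] by simp
    then have "pos S" unfolding S_def using t by (intro pos_scale) auto
    moreover have "S * S = T"
    proof -
      have "S * S = rs (sqrt t) * rs (sqrt t) * ((1 - Y) * (1 - Y))"
        using Y(1) by (simp add: S_def mult.assoc rs_left_commute[of "1 - Y"])
      also have "\<dots> = rs t * (rs (1 / t) * T)"
        using t by (simp add: rs_mult[symmetric] Y(3) V_def)
      also have "\<dots> = T" using t0 by (simp add: rs_rs)
      finally show ?thesis .
    qed
    moreover have "C * S = S * C" if C: "C \<in> Lop" "C * T = T * C" for C
    proof -
      have "C * V = V * C" unfolding V_def using C(2) rs_left_commute[OF C(1)]
        by (simp add: left_diff_distrib right_diff_distrib mult.assoc)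
      then have "C * Y = Y * C" using Y(4) C by blast
      then have "C * (1 - Y) = (1 - Y) * C" by (simp add: algebra_simps)
      then show ?thesis unfolding S_def using rs_left_commute[OF C(1)] by (simp add: mult.assoc)
    qed
    ultimately show ?thesis using that by blast
  qed
qed

subsection \<open>Positive operators\<close>

text \<open>For \<open>Z = X + \<i> Y\<close> commutation gives
  \<open>star Z * Z = X * X + Y * Y\<close>, and \<open>X\<close> is the real part of
  \<open>Z\<close>.\<close>

lemma bd_sum_sq:
  assumes "sa X" "sa Y" "X * Y = Y * X" "bd (X * X + Y * Y) (t\<^sup>2)" "0 \<le> t"
  shows "bd X t"
proof -
  define Z where "Z = X + scal \<i> * Y"
  have Z: "Z \<in> Lop" using assms by (simp add: Z_def)
  have sZ: "star Z = X - scal \<i> * Y"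
    using assms by (simp add: Z_def scal_minus scal_commute[of Y])
  have "star Z * Z = X * X + Y * Y"
  proof -
    have "star Z * Z = X * X + scal \<i> * (X * Y) - scal \<i> * (Y * X) - scal (\<i> * \<i>) * (Y * Y)"
      unfolding sZ using assms(1,2)
      by (simp add: Z_def algebra_simps scal_left_commute[of X] scal_left_commute[of Y] scal_scal del: complex_i_mult_minus)
    then show ?thesis using assms(3) by (simp add: scal_minus)
  qed
  then have bZ: "bd Z t" using bd_star_mult[OF Z _ assms(5)] assms(4) by simp
  have "bd (rs (1/2) * (Z + star Z)) (1/2 * (t + t))"
    using assms(5) by (intro bd_rs_mult bd_add bZ bd_star[OF Z bZ]) auto
  moreover have "Z + star Z = X + X" by (simp add: sZ) (simp add: Z_def)
  ultimately show ?thesis by (simp add: half_double)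
qed

text \<open>Rescale \<open>X\<close> to a contraction \<open>X'\<close> and let \<open>S\<close> be
  the self-adjoint root of \<open>1 - X' * X'\<close> commuting with \<open>X'\<close>. Then
  \<open>S * S + X' * X' = 1\<close> bounds \<open>S\<close> by 1, hence also
  \<open>1 - X' * X' = S * S\<close>, which is positivity of \<open>X' * X'\<close>.\<close>

lemma pos_sq:
  assumes "sa X"
  shows "pos (X * X)"
proof -
  obtain b where b: "0 < b" "bd X b" using assms Lop_bounded sa_Lop by blast
  define X' where "X' = rs (1 / b) * X"
  have X': "sa X'" "bd X' 1"
    using sa_rs_mult[OF assms] bd_rs_mult[of "1 / b", OF _ b(2)] b(1) by (auto simp: X'_def)
  have sq: "X * X = rs (b * b) * (X' * X')"
    using b assms by (simp add: X'_def rs_left_commute[of X] rs_rs mult.assoc)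
  have "sa (X' * X')" "bd (X' * X') 1"
    using X' sa_mult bd_mult[OF X'(2) X'(2)] by auto
  then obtain Y where Y: "sa Y" "(1 - Y) * (1 - Y) = 1 - X' * X'"
      "\<And>C. C \<in> Lop \<Longrightarrow> C * (X' * X') = X' * X' * C \<Longrightarrow> C * Y = Y * C"
    using sqrt_one_minus by metis
  let ?S = "1 - Y"
  have "X' * Y = Y * X'" using Y(3)[of X'] X' by (simp add: mult.assoc)
  then have "?S * X' = X' * ?S" by (simp add: algebra_simps)
  moreover have "sa ?S" using Y(1) by (intro sa_diff) auto
  moreover have "?S * ?S + X' * X' = 1" using Y(2) by simp
  ultimately have "bd ?S 1" using bd_sum_sq[of ?S X' 1] X' by (simp add: bd_1)
  then have "bd (rs 1 - X' * X') 1" using bd_mult[of ?S 1 ?S 1] Y(2) by simp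
  then have "pos (X' * X')" using \<open>sa (X' * X')\<close> by (intro posI[of _ 1]) auto
  then show ?thesis unfolding sq using b by (intro pos_scale) auto
qed

text \<open>Commuting roots \<open>X\<close> of \<open>T\<close> and \<open>Y\<close> of
  \<open>- T\<close> have \<open>X * X + Y * Y = 0\<close>, so \<open>X\<close> has bound 0.\<close>

lemma pos_antisym:
  assumes "pos T" "pos (- T)"
  shows "T = 0"
proof -
  obtain X where X: "pos X" "X * X = T" using pos_sqrt[OF assms(1)] by blast
  obtain Y where Y: "pos Y" "Y * Y = - T" "\<And>C. C \<in> Lop \<Longrightarrow> C * - T = - T * C \<Longrightarrow> C * Y = Y * C"
    using pos_sqrt[OF assms(2)] by blast
  have "X * T = T * X" using X by (metis mult.assoc)
  then have "X * Y = Y * X" using Y(3)[of X] X(1) by simp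
  then have "bd X 0" using bd_sum_sq[of X Y 0] X Y(1,2) by (simp add: bd_0)
  then show ?thesis using bd_0_eq X by fastforce
qed

text \<open>Commuting roots of \<open>T\<close> and of \<open>rs t - T\<close> have squares adding
  up to \<open>rs t\<close>, so the root of \<open>T\<close> is bounded by
  \<open>sqrt t\<close>.\<close>

lemma bd_of_pos:
  assumes "pos T" "pos (rs t - T)" "0 \<le> t"
  shows "bd T t"
proof -
  obtain X where X: "pos X" "X * X = T" using pos_sqrt[OF assms(1)] by blast
  obtain Y where Y: "pos Y" "Y * Y = rs t - T"
      "\<And>C. C \<in> Lop \<Longrightarrow> C * (rs t - T) = (rs t - T) * C \<Longrightarrow> C * Y = Y * C"
    using pos_sqrt[OF assms(2)] by blast
  have "X * T = T * X" using X by (metis mult.assoc)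
  then have "X * (rs t - T) = (rs t - T) * X"
    using rs_commute[of X t] X(1) by (simp add: algebra_simps)
  then have "X * Y = Y * X" using Y(3) X(1) pos_Lop by blast
  moreover have "bd (X * X + Y * Y) ((sqrt t)\<^sup>2)" using X Y(1,2) assms(3) by (simp add: bd_rs)
  ultimately have "bd X (sqrt t)" using bd_sum_sq[of X Y] X(1) Y(1) assms(3) by simp
  then show ?thesis using bd_mult[of X "sqrt t" X "sqrt t"] X assms(3) by simp
qed

lemma bd_pos_mono:
  assumes "pos S" "pos (T - S)" "bd T t" "0 \<le> t"
  shows "bd S t"
proof -
  have T: "sa T" using sa_add[of "T - S" S] assms by simp
  have "pos (rs t - T + (T - S))" using pos_add[OF pos_rs_minus[OF T assms(3,4)] assms(2)] .
  then show ?thesis using bd_of_pos[OF assms(1) _ assms(4)] by simp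
qed

text \<open>This replaces the comparison of the spectra of \<open>star C * C\<close> and
  \<open>C * star C\<close>. Multiplying \<open>C\<close> by the root of \<open>p\<close> turns both
  products into negatives of squares, \<open>- (p * p)\<close> and \<open>- (q * q)\<close>. Twice
  their sum is also the sum of the squares of the self-adjoint \<open>D + star D\<close> and
  \<open>\<i> (D - star D)\<close>, hence positive, and antisymmetry forces
  \<open>p * p = 0\<close>.\<close>

lemma neg_star_mult_eq_0:
  assumes C: "C \<in> Lop" and neg: "pos (- (star C * C))"
  shows "C = 0"
proof -
  define p where "p = - (star C * C)"
  define q where "q = C * star C"
  obtain r where r: "pos r" "r * r = p" using pos_sqrt[OF neg] p_def by metis
  define D where "D = C * r"
  have cc: "star C * C = - p" by (simp add: p_def)
  have p: "sa p" using neg by (simp add: p_def)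
  have q: "sa q" unfolding q_def using C by (intro saI) auto
  have D: "D \<in> Lop" and sD: "star D = r * star C" using C r by (simp_all add: D_def)
  have "star D * D = r * (star C * C) * r" by (simp add: sD) (simp add: D_def mult.assoc)
  then have DD: "star D * D = - (p * p)"
    using r by (simp add: cc) (metis mult.assoc)
  have "D * star D = C * p * star C" by (simp add: sD) (simp add: D_def r(2)[symmetric] mult.assoc)
  also have "\<dots> = - (q * q)" by (simp add: p_def q_def mult.assoc)
  finally have DD': "D * star D = - (q * q)" .
  define X where "X = D + star D"
  define Y where "Y = scal \<i> * (D - star D)"
  have saX: "sa X" unfolding X_def using D by (intro saI) (auto simp: add.commute)
  have saY: "sa Y"
  proof (rule saI)
    have "star Y = (star D - D) * scal (- \<i>)" using D by (simp add: Y_def)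
    also have "\<dots> = scal (- \<i>) * (star D - D)" using D by (intro scal_commute) simp
    also have "\<dots> = Y" by (simp add: Y_def scal_minus algebra_simps)
    finally show "star Y = Y" .
  qed (simp add: Y_def D)
  have "Y * Y = scal (\<i> * \<i>) * ((D - star D) * (D - star D))"
    using D by (simp add: Y_def mult.assoc scal_left_commute[of "D - star D"] scal_scal)
  then have "X * X + Y * Y = (D * star D + star D * D) + (D * star D + star D * D)"
    unfolding X_def by (simp add: scal_minus algebra_simps)
  then have "X * X + Y * Y = - ((p * p + p * p) + (q * q + q * q))"
    by (simp add: DD DD')
  then have "pos (- ((p * p + p * p) + (q * q + q * q)))"
    using pos_add[OF pos_sq[OF saX] pos_sq[OF saY]] by simp
  moreover have pp: "pos (p * p + p * p)" "pos (q * q + q * q)"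
    using pos_sq p q pos_add by blast+
  ultimately have "(p * p + p * p) + (q * q + q * q) = 0"
    using pos_antisym pos_add by blast
  then have "p * p + p * p = 0"
    using pos_antisym[OF pp(1)] pp(2) by (metis add_eq_0_iff2 minus_unique)
  then have "p * p = 0" using half_double[of "p * p"] by simp
  then have "star C * C = 0" using sa_sq_eq_0[OF p] by (simp add: cc)
  then show ?thesis using star_mult_self_eq_0 C by blast
qed

text \<open>With \<open>h = star B * B\<close> and \<open>w = |h| - h\<close>, the operator \<open>C = B * w\<close> satisfies
  \<open>star C * C = - w |h| w \<le> 0\<close>, hence \<open>C = 0\<close>, which forces \<open>w = 0\<close>.\<close>

lemma pos_star_mult:
  assumes B: "B \<in> Lop"
  shows "pos (star B * B)"
proof -
  define h where "h = star B * B"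
  have h: "sa h" unfolding h_def using B by (rule sa_star_mult)
  obtain p where p: "pos p" "p * p = h * h" "\<And>C. C \<in> Lop \<Longrightarrow> C * (h * h) = h * h * C \<Longrightarrow> C * p = p * C"
    using pos_sqrt[OF pos_sq[OF h]] by blast
  have hp: "h * p = p * h" using p(3)[of h] h by (simp add: mult.assoc)
  obtain q where q: "pos q" "q * q = p" "\<And>C. C \<in> Lop \<Longrightarrow> C * p = p * C \<Longrightarrow> C * q = q * C"
    using pos_sqrt[OF p(1)] by blast
  define w where "w = p - h"
  have w: "sa w" unfolding w_def using p(1) h by (intro sa_diff) auto
  have wp: "w * p = p * w" using hp by (simp add: w_def algebra_simps)
  have wq: "w * q = q * w" using q(3)[of w] wp w by simp
  have hw: "h * w = - (p * w)" using hp p(2) by (simp add: w_def algebra_simps)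
  define C where "C = B * w"
  have C: "C \<in> Lop" using B w by (simp add: C_def)
  have "star C * C = w * (h * w)" using B w by (simp add: C_def h_def mult.assoc)
  also have "\<dots> = - (w * p * w)" by (simp add: hw mult.assoc)
  also have "w * p * w = (q * w) * (q * w)"
    using wq by (metis mult.assoc q(2))
  finally have CC: "- (star C * C) = (q * w) * (q * w)" by simp
  have qw: "sa (q * w)" using sa_mult[of q w] q(1) w wq by simp
  have "C = 0" using neg_star_mult_eq_0[OF C] CC pos_sq[OF qw] by simp
  then have "(q * w) * (q * w) = 0" using CC by simp
  then have "q * w = 0" using sa_sq_eq_0 qw by blast
  then have "p * w = 0" using q(2) by (metis mult.assoc mult_zero_right)
  moreover have "w * w = p * w + p * w" using hw by (simp add: w_def algebra_simps)
  ultimately have "w * w = 0" by simp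
  then have "w = 0" using sa_sq_eq_0 w by blast
  then show ?thesis using p(1) by (simp add: w_def h_def)
qed

lemma pos_conj:
  assumes "pos T" "R \<in> Lop"
  shows "pos (star R * T * R)"
proof -
  obtain X where X: "pos X" "X * X = T" using pos_sqrt[OF assms(1)] by blast
  have "star R * T * R = star (X * R) * (X * R)" using X assms by (auto simp: mult.assoc)
  then show ?thesis using pos_star_mult[of "X * R"] X assms by simp
qed

text \<open>Each root commutes with its square, hence with the root \<open>Z\<close> supplied by
  \<open>pos_sqrt\<close>, which reduces the claim to commuting \<open>A\<close>, \<open>B\<close>.
  There \<open>D = A - B\<close> satisfies \<open>D * A * D + D * B * D = 0\<close> with both terms
  positive; both vanish, so \<open>D * D * D = 0\<close>.\<close>

lemma pos_sqrt_unique: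
  assumes "pos S" "pos R" "S * S = R * R"
  shows "S = R"
proof -
  have *: "A = B" if AB: "pos A" "pos B" "A * A = B * B" "A * B = B * A" for A B
  proof -
    define D where "D = A - B"
    have D: "sa D" unfolding D_def using AB(1,2) by (intro sa_diff) auto
    have "D * (A + B) = 0" using AB by (simp add: D_def algebra_simps)
    then have z: "D * A * D + D * B * D = 0" by (metis distrib_left distrib_right mult_zero_left)
    have pA: "pos (D * A * D)" and pB: "pos (D * B * D)"
      using pos_conj[of A D] pos_conj[of B D] AB(1,2) D by simp_all
    have "D * A * D = 0" using pos_antisym[OF pA] pB z by (metis minus_unique)
    moreover from this z have "D * B * D = 0" by simp
    moreover have "D * (A - B) * D = D * A * D - D * B * D" by (simp add: algebra_simps)
    ultimately have "D * D * D = 0" by (simp flip: D_def)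
    then have "(D * D) * (D * D) = 0" by (metis mult.assoc mult_zero_left)
    then have "D * D = 0" using sa_sq_eq_0 sa_mult D by blast
    then have "D = 0" using sa_sq_eq_0 D by blast
    then show ?thesis by (simp add: D_def)
  qed
  have "pos (S * S)" using pos_sq assms by simp
  then obtain Z where Z: "pos Z" "Z * Z = S * S" "\<And>C. C \<in> Lop \<Longrightarrow> C * (S * S) = S * S * C \<Longrightarrow> C * Z = Z * C"
    using pos_sqrt by blast
  have "S = Z" using *[of S Z] assms(1) Z(1,2) Z(3)[of S] by (simp add: mult.assoc)
  moreover have "R = Z" using *[of R Z] assms Z(1,2) Z(3)[of R] by (simp add: mult.assoc)
  ultimately show ?thesis by simp
qed

text \<open>A Neumann series for \<open>1 - (T + \<delta>) / t\<close>, whose norm is at most \<open>1 - \<delta> / t\<close>.\<close>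

lemma pos_invertible:
  assumes T: "pos T" and d: "0 < \<delta>"
  obtains J where "sa J" "J * (T + rs \<delta>) = 1" "(T + rs \<delta>) * J = 1"
    "\<And>C. C \<in> Lop \<Longrightarrow> C * T = T * C \<Longrightarrow> C * J = J * C"
proof -
  let ?T = "T + rs \<delta>"
  have saT: "sa ?T" using T by (intro sa_add) auto
  obtain t0 where t0: "0 < t0" "bd ?T t0" using saT Lop_bounded sa_Lop by blast
  \<comment> \<open>Besides bounding \<open>?T\<close>, \<open>t\<close> must exceed
    \<open>\<delta>\<close>, so that the ratio \<open>k\<close> of the series lies in
    \<open>[0, 1)\<close>.\<close>
  define t where "t = max t0 (2 * \<delta>)"
  have t: "0 < t" "bd ?T t" "\<delta> < t" using t0 d bd_mono[OF t0(2)] by (auto simp: t_def)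
  define k where "k = 1 - \<delta> / t"
  have k: "0 \<le> k" "k < 1" using t d by (auto simp: k_def field_simps)
  define V where "V = 1 - rs (1 / t) * ?T"
  have V: "V = rs (1 / t) * (rs t - ?T)"
    using t rs_mult[of "1 / t" t] by (simp add: V_def right_diff_distrib)
  have "pos (rs t - ?T)" using pos_rs_minus[OF saT t(2)] t by simp
  then have posV: "pos V" unfolding V using t by (intro pos_scale) auto
  have "rs k - V = rs (1 / t) * T"
    using rs_mult[of "1 / t" \<delta>] by (simp add: V_def k_def rs_diff algebra_simps)
  then have "pos (rs k - V)" using pos_scale[OF T, of "1 / t"] t by simp
  then have bdV: "bd V k" using bd_of_pos posV k by blast
  define Y where "Y = rec_nat 0 (\<lambda>n y. 1 + V * y)"
  have Y0: "Y 0 = 0" and YS: "Y (Suc n) = 1 + V * Y n" for n by (simp_all add: Y_def)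
  have YL: "Y n \<in> Lop" for n using posV by (induction n) (simp_all add: Y0 YS)
  have Ycomm: "C * Y n = Y n * C" if "C * V = V * C" for C n
  proof (induction n)
    case (Suc n)
    have "C * (V * Y n) = V * Y n * C" using Suc that by (metis mult.assoc)
    then show ?case by (simp add: YS algebra_simps)
  qed (simp add: Y0)
  have bdd: "bd (Y (Suc n) - Y n) (k ^ n)" for n
  proof (induction n)
    case (Suc n)
    have "Y (Suc (Suc n)) - Y (Suc n) = V * (Y (Suc n) - Y n)"
      unfolding YS[of "Suc n"] YS[of n] by (simp add: algebra_simps)
    then show ?case using bd_mult[OF bdV Suc k(1)] by simp
  qed (simp add: Y0 YS bd_1)
  have "summable (\<lambda>n. k ^ n)" using k by (intro summable_geometric) simp
  then obtain Z where Z: "Z \<in> Lop" "\<And>x. conv (\<lambda>n. Y n \<cdot> x) (Z \<cdot> x)"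
    using Lop_limit[of Y, OF YL bdd _ zero_le_power[OF k(1)]] by blast
  have Zcomm: "C * Z = Z * C" if "C \<in> Lop" "C * V = V * C" for C
    using commute_limit[OF Ycomm[OF that(2)] that(1) Z(2)] .
  have eq: "Z = 1 + V * Z"
  proof (rule endo_eqI, rule ip_eqI_left)
    fix x z
    have 1: "(\<lambda>n. \<langle>Y (Suc n) \<cdot> x, z\<rangle>) \<longlonglongrightarrow> \<langle>Z \<cdot> x, z\<rangle>"
      by (intro conv_ip conv_Suc[OF Z(2)] conv_const)
    have "\<langle>Y (Suc n) \<cdot> x, z\<rangle> = \<langle>x, z\<rangle> + \<langle>Y n \<cdot> x, V \<cdot> z\<rangle>" for n
      using posV by (simp add: YS ip_add_left star_right[of V])
    then have 2: "(\<lambda>n. \<langle>Y (Suc n) \<cdot> x, z\<rangle>) \<longlonglongrightarrow> \<langle>x, z\<rangle> + \<langle>Z \<cdot> x, V \<cdot> z\<rangle>"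
      by (simp, intro tendsto_intros conv_ip Z(2) conv_const)
    show "\<langle>Z \<cdot> x, z\<rangle> = \<langle>(1 + V * Z) \<cdot> x, z\<rangle>"
      using LIMSEQ_unique[OF 1 2] posV by (simp add: ip_add_left star_right[of V])
  qed
  define J where "J = rs (1 / t) * Z"
  have JL: "J \<in> Lop" using Z by (simp add: J_def)
  have VZ: "V * Z = Z * V" using Zcomm[of V] posV by simp
  have TJ: "?T * J = 1"
  proof -
    have "?T * J = rs (1 / t) * ?T * Z" unfolding J_def using saT by (simp add: rs_left_commute[of ?T] mult.assoc)
    also have "\<dots> = (1 - V) * Z" by (simp add: V_def)
    also have "\<dots> = 1" using eq by (simp add: left_diff_distrib) (metis add_diff_cancel_right')
    finally show ?thesis .
  qed
  have JT: "J * ?T = 1"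
  proof -
    have "J * ?T = Z * (rs (1 / t) * ?T)" unfolding J_def using Z(1) by (simp add: rs_left_commute[of Z] mult.assoc)
    also have "\<dots> = Z * (1 - V)" by (simp add: V_def)
    also have "\<dots> = 1" using eq VZ by (simp add: right_diff_distrib) (metis add_diff_cancel_right')
    finally show ?thesis .
  qed
  have "star J = J"
  proof -
    have "star J * ?T = 1" using arg_cong[OF TJ, of star] JL saT by simp
    then show ?thesis by (metis TJ mult.assoc mult_1_left mult_1_right)
  qed
  then have saJ: "sa J" using JL by (intro saI)
  have "C * J = J * C" if C: "C \<in> Lop" "C * T = T * C" for C
  proof -
    have "C * ?T = ?T * C" using C(2) rs_commute[OF C(1)] by (simp add: distrib_left distrib_right)
    then have "J * (C * ?T) * J = J * (?T * C) * J" by simp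
    then have "J * C * (?T * J) = J * ?T * (C * J)" by (simp only: mult.assoc)
    then show ?thesis by (simp only: JT TJ mult_1_left mult_1_right)
  qed
  then show ?thesis using that saJ JT TJ by blast
qed

end

section \<open>The Cauchy--Schwarz inequality\<close>

definition self_mod :: "('h, 'a::{real_normed_algebra,banach}) hmod \<Rightarrow> ('a, 'a) hmod"
  where "self_mod H = \<lparr>hm_scA = hm_scA H, hm_star = hm_star H, hm_scH = hm_scA H,
    hm_act = (*), hm_ip = (\<lambda>x y. hm_star H x * y)\<rparr>"

lemma self_mod_simps [simp]:
  "hm_scA (self_mod H) = hm_scA H" "hm_star (self_mod H) = hm_star H"
  "hm_scH (self_mod H) = hm_scA H" "hm_act (self_mod H) = (*)"
  "hm_ip (self_mod H) x y = hm_star H x * y"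
  by (simp_all add: self_mod_def)

context hilbert_mod
begin

lemma hnorm_self_mod [simp]: "hnorm (self_mod H) a = norm a"
  by (simp add: hnorm_def norm_st_mult)

text \<open>By the \<open>C\<^sup>*\<close>-identity the module norm is the norm of the algebra, so
  completeness and Cauchy--Schwarz are those of a Banach algebra with isometric involution.\<close>

lemma cs_self_mod: "cs_hilbert_mod (self_mod H)"
proof
  have compl: "\<forall>f :: nat \<Rightarrow> 'a. (\<forall>e>0. \<exists>k. \<forall>m\<ge>k. \<forall>n\<ge>k. norm (f m - f n) < e) \<longrightarrow>
      (\<exists>l. \<forall>e>0. \<exists>k. \<forall>n\<ge>k. norm (f n - l) < e)"
    by (metis CauchyI Cauchy_convergent_iff convergent_def LIMSEQ_iff)
  have one: "scA 1 a = a" for a using scA_of_real[of 1 a] by simp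
  have zero: "\<forall>a. st a * a = 0 \<longrightarrow> a = 0" using norm_st_mult by (metis norm_eq_zero power_eq_0_iff zero_neq_numeral)
  have pos: "\<forall>a. positive_el (self_mod H) (st a * a)" by (auto simp: positive_el_def)
  show "hilbert_module (self_mod H)"
    unfolding hilbert_module_def hnorm_self_mod self_mod_simps
    by (intro conjI cstar compl zero pos)
       (simp_all add: scA_add scA_add_left scA_scA one scA_mult_left[symmetric] scA_mult_right[symmetric]
         distrib_left distrib_right mult.assoc st_mult)
  show "norm (hm_ip (self_mod H) x y) \<le> hnorm (self_mod H) x * hnorm (self_mod H) y" for x y
    using norm_mult_ineq[of "st x" y] by simp
qed

text \<open>With \<open>p = \<langle>x, x\<rangle>\<close>, \<open>a = \<langle>x, y\<rangle>\<close>, \<open>q = \<langle>y, y\<rangle>\<close> and \<open>r = norm p\<close>, positivity of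
  \<open>\<langle>x a - r y, x a - r y\<rangle>\<close> and of \<open>a\<^sup>* (r - p) a\<close> gives \<open>r a\<^sup>* a \<le> r\<^sup>2 q\<close>, read in the algebra of
  operators on \<open>'a\<close> because \<open>'a\<close> need not be unital.\<close>

lemma cs_hilbert_mod: "cs_hilbert_mod H"
proof
  fix x y
  interpret K: cs_hilbert_mod "self_mod H" by (rule cs_self_mod)
  define lm where "lm a = Endo ((*) a)" for a :: 'a
  have lm [simp]: "lm a \<cdot> z = a * z" for a z by (simp add: lm_def app_Endo distrib_left)
  have lm_mult: "lm (a * b) = lm a * lm b" for a b by (rule endo_eqI) (simp add: mult.assoc)
  have lm_add: "lm (a + b) = lm a + lm b" for a b by (rule endo_eqI) (simp add: distrib_right)
  have lm_diff: "lm (a - b) = lm a - lm b" for a b by (rule endo_eqI) (simp add: left_diff_distrib)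
  have lm_scale: "lm (t *\<^sub>R a) = K.rs t * lm a" for t a
    by (rule endo_eqI) (simp add: K.rs_app scA_of_real)
  have lm_adj: "K.is_adj (lm a) (lm (st a))" for a
    by (simp add: K.is_adj_def st_mult mult.assoc)
  have lmL: "lm a \<in> K.Lop" and lm_star: "K.star (lm a) = lm (st a)" for a
    using lm_adj K.is_adj_Lop K.is_adj_star_eq by blast+
  have lm_sa: "K.sa (lm a)" if "st a = a" for a
    using lmL lm_star that by (intro K.saI) auto
  have lm_bd: "K.bd (lm a) (norm a)" for a
    by (simp add: K.bd_def norm_mult_ineq)
  have lm_pos: "K.pos (lm (st a * a))" for a
    using K.pos_star_mult[OF lmL, of a] by (simp add: lm_star lm_mult)
  define p a q r where "p = \<langle>x, x\<rangle>" and "a = \<langle>x, y\<rangle>" and "q = \<langle>y, y\<rangle>" and "r = norm p"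
  show "norm \<langle>x, y\<rangle> \<le> N x * N y"
  proof (cases "r = 0 \<or> a = 0")
    case True
    then have "a = 0" using ip_self_eq_0[of x] by (auto simp: r_def p_def a_def)
    then show ?thesis by (simp add: a_def)
  next
    case False
    then have r: "r > 0" "a \<noteq> 0" by (auto simp: r_def)
    define v where "v = act x a - sc (complex_of_real r) y"
    obtain e where e: "\<langle>v, v\<rangle> = st e * e" using positive_ip[of v] by (auto simp: positive_el_def)
    have yx: "\<langle>y, x\<rangle> = st a" by (simp add: a_def ip_st[of y x])
    have "\<langle>v, v\<rangle> = st a * (p * a) - r *\<^sub>R (st a * a) - r *\<^sub>R (st a * a) + (r * r) *\<^sub>R q"
      by (simp add: v_def ip_diff_left ip_diff_right ip_act_left ip_act_right ip_sc_left ip_sc_right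
          scA_of_real yx mult.assoc algebra_simps flip: p_def a_def q_def)
    then have P1: "K.pos (lm (st a) * (lm p * lm a) - K.rs r * lm (st a * a) - K.rs r * lm (st a * a)
        + lm ((r * r) *\<^sub>R q))"
      using lm_pos[of e] unfolding e by (simp add: lm_mult lm_add lm_diff lm_scale)
    have "K.pos (K.rs r - lm p)"
      using lm_bd[of p] by (intro K.pos_rs_minus lm_sa) (auto simp: r_def p_def ip_st[symmetric])
    then have "K.pos (K.star (lm a) * (K.rs r - lm p) * lm a)" using lmL by (rule K.pos_conj)
    moreover have "K.star (lm a) * (K.rs r - lm p) * lm a = K.rs r * lm (st a * a) - lm (st a) * (lm p * lm a)"
      using K.rs_commute[OF lmL, of "st a" r]
      by (simp add: lm_star lm_mult right_diff_distrib left_diff_distrib) (simp add: mult.assoc)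
    ultimately have P2: "K.pos (K.rs r * lm (st a * a) - lm (st a) * (lm p * lm a))" by simp
    have "K.pos (lm ((r * r) *\<^sub>R q) - K.rs r * lm (st a * a))"
      using K.pos_add[OF P1 P2] by simp
    moreover have "K.pos (K.rs r * lm (st a * a))"
      using r lm_pos by (intro K.pos_scale) auto
    ultimately have "K.bd (K.rs r * lm (st a * a)) (norm ((r * r) *\<^sub>R q))"
      using K.bd_pos_mono lm_bd norm_ge_zero by blast
    \<comment> \<open>Evaluating the operator bound at the vector \<open>st a * a\<close> brings it
      back to the algebra: the \<open>C\<^sup>*\<close>-identity makes the left side
      \<open>r\<close> times the fourth power of \<open>norm a\<close>, and
      \<open>(norm a)\<^sup>2\<close> cancels.\<close>
    then have "norm (r *\<^sub>R ((st a * a) * (st a * a))) \<le> norm ((r * r) *\<^sub>R q) * norm (st a * a)"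
      unfolding K.bd_def by (metis K.rs_app endo_app(5) hnorm_self_mod lm scA_of_real self_mod_simps(3))
    moreover have "norm ((st a * a) * (st a * a)) = (norm a)\<^sup>2 * (norm a)\<^sup>2"
      using norm_st_mult[of "st a * a"] by (simp add: st_mult norm_st_mult power2_eq_square)
    ultimately have "r * ((norm a)\<^sup>2 * (norm a)\<^sup>2) \<le> r * r * norm q * (norm a)\<^sup>2"
      using r by (simp add: norm_st_mult)
    then have "(norm a)\<^sup>2 * (r * (norm a)\<^sup>2) \<le> (norm a)\<^sup>2 * (r * (r * norm q))"
      by (simp add: algebra_simps)
    then have "(norm a)\<^sup>2 \<le> r * norm q" using r by simp
    also have "\<dots> = (N x * N y)\<^sup>2" by (simp add: power_mult_distrib N_sq r_def p_def q_def)
    finally show ?thesis unfolding a_def by (rule power2_le_imp_le) simp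
  qed
qed

end

section \<open>Ranges and polar decomposition\<close>

context cs_hilbert_mod
begin

lemma hclosure_superset: "S \<subseteq> hclosure H S"
  by (force simp: hclosure_def)

lemma hclosure_subset:
  assumes "S \<subseteq> hclosure H R"
  shows "hclosure H S \<subseteq> hclosure H R"
proof
  fix x assume x: "x \<in> hclosure H S"
  have "\<exists>z\<in>R. N (x - z) < e" if e: "e > 0" for e
  proof -
    obtain y where y: "y \<in> S" "N (x - y) < e / 2" using x e unfolding hclosure_def by (auto dest: spec[of _ "e / 2"])
    obtain z where "z \<in> R" "N (y - z) < e / 2" using assms y(1) e unfolding hclosure_def by (auto dest!: subsetD dest: spec[of _ "e / 2"])
    then show ?thesis using y N_triangle_diff[of x z y] by (intro bexI[of _ z]) auto
  qed
  then show "x \<in> hclosure H R" by (simp add: hclosure_def)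
qed

lemma hclosure_range_seq:
  "p \<in> hclosure H (range (app A)) \<longleftrightarrow> (\<exists>f. \<forall>n. N (p - A \<cdot> f n) < (1/2) ^ n)"
proof
  assume "p \<in> hclosure H (range (app A))"
  then have "\<exists>y. N (p - A \<cdot> y) < (1/2) ^ n" for n :: nat by (auto simp: hclosure_def)
  then show "\<exists>f. \<forall>n. N (p - A \<cdot> f n) < (1/2) ^ n" by metis
next
  assume "\<exists>f. \<forall>n. N (p - A \<cdot> f n) < (1/2) ^ n"
  then obtain f where f: "\<And>n. N (p - A \<cdot> f n) < (1/2) ^ n" by blast
  have "\<exists>y. N (p - A \<cdot> y) < e" if "e > 0" for e
  proof -
    obtain n where "(1/2 :: real) ^ n < e" using real_arch_pow_inv[of e "1/2"] \<open>e > 0\<close> by auto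
    then show ?thesis using f[of n] by (meson less_trans)
  qed
  then show "p \<in> hclosure H (range (app A))" by (auto simp: hclosure_def)
qed

lemma conv_in_hclosure: "conv (\<lambda>n. A \<cdot> f n) p \<Longrightarrow> p \<in> hclosure H (range (app A))"
proof -
  assume c: "conv (\<lambda>n. A \<cdot> f n) p"
  have "\<exists>y. N (p - A \<cdot> y) < e" if "e > 0" for e
    using order_tendstoD(2)[OF c[unfolded conv_def] that]
    by (metis (lifting) N_minus_commute eventually_happens sequentially_bot)
  then show ?thesis by (auto simp: hclosure_def)
qed

text \<open>With \<open>S = T * star T\<close> and \<open>J\<close> the inverse of \<open>S + \<epsilon>\<close>, the operator
  \<open>star T - star T * S * J = \<epsilon> * star T * J\<close> has norm at most \<open>sqrt \<epsilon>\<close>.\<close>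

lemma hclosure_range_star:
  assumes T: "T \<in> Lop"
  shows "hclosure H (range (app (star T * T))) = hclosure H (range (app (star T)))"
proof
  show "hclosure H (range (app (star T * T))) \<subseteq> hclosure H (range (app (star T)))"
    by (rule hclosure_subset, rule order_trans[OF _ hclosure_superset]) auto
  have "\<exists>y. N (star T \<cdot> x - (star T * T) \<cdot> y) < e" if e: "e > 0" for x e
  proof -
    \<comment> \<open>The summand 1 keeps the denominator positive and gives
      \<open>k * N x < e\<close> even for \<open>x = 0\<close>.\<close>
    define k where "k = e / (N x + 1)"
    have "N x + 1 > 0" using N_ge_0[of x] by linarith
    then have k: "k > 0" "k * N x < e" using e by (simp_all add: k_def field_simps)
    define S where "S = T * star T"
    have S: "pos S" using pos_star_mult[of "star T"] T by (simp add: S_def)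
    define \<epsilon> where "\<epsilon> = k\<^sup>2"
    have \<epsilon>: "\<epsilon> > 0" using k by (simp add: \<epsilon>_def)
    obtain J where J: "sa J" "J * (S + rs \<epsilon>) = 1" "(S + rs \<epsilon>) * J = 1"
      using pos_invertible[OF S \<epsilon>] by blast
    define X where "X = rs \<epsilon> * (star T * J)"
    have XL: "X \<in> Lop" using T J by (simp add: X_def)
    have XX: "star X * X = rs (\<epsilon> * \<epsilon>) * (J * S * J)"
      using T J(1) by (simp add: X_def S_def mult.assoc rs_left_commute[of T] rs_left_commute[of J] rs_commute[of T] rs_commute[of J] rs_rs)
    \<comment> \<open>Both \<open>rs \<epsilon>\<close> and \<open>star X * X\<close> are written as
      \<open>J\<close> times something times \<open>J\<close>. The difference of the middle factors
      is a polynomial in \<open>S\<close> with nonnegative coefficients, hence positive.\<close>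
    let ?G = "S + rs \<epsilon>"
    have "J * (rs \<epsilon> * (?G * ?G)) * J = rs \<epsilon> * ((J * ?G) * (?G * J))"
      using J(1) by (simp only: mult.assoc rs_left_commute[of J] sa_Lop)
    then have 1: "rs \<epsilon> = J * (rs \<epsilon> * (?G * ?G)) * J" by (simp only: J mult_1_right)
    have 2: "rs (\<epsilon> * \<epsilon>) * (J * S * J) = J * (rs (\<epsilon> * \<epsilon>) * S) * J"
      using J(1) by (simp add: mult.assoc rs_left_commute[of J])
    have 3: "rs \<epsilon> * (?G * ?G) - rs (\<epsilon> * \<epsilon>) * S = rs \<epsilon> * (S * S) + rs (\<epsilon> * \<epsilon>) * S + rs (\<epsilon> * \<epsilon> * \<epsilon>)"
      using S by (simp add: algebra_simps rs_mult rs_commute[of S])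
    have "rs \<epsilon> - star X * X = J * (rs \<epsilon> * (?G * ?G) - rs (\<epsilon> * \<epsilon>) * S) * J"
      unfolding XX by (subst 1, subst 2) (simp only: left_diff_distrib right_diff_distrib)
    then have "rs \<epsilon> - star X * X = J * (rs \<epsilon> * (S * S) + rs (\<epsilon> * \<epsilon>) * S + rs (\<epsilon> * \<epsilon> * \<epsilon>)) * J"
      by (simp only: 3)
    moreover have "pos (rs \<epsilon> * (S * S) + rs (\<epsilon> * \<epsilon>) * S + rs (\<epsilon> * \<epsilon> * \<epsilon>))"
      using S \<epsilon> by (intro pos_add pos_scale pos_rs pos_sq) auto
    ultimately have "pos (rs \<epsilon> - star X * X)"
      using pos_conj[OF _ sa_Lop[OF J(1)]] J(1) by simp
    then have "bd (star X * X) (k\<^sup>2)"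
      using bd_of_pos[OF pos_star_mult[OF XL]] \<epsilon> by (simp add: \<epsilon>_def)
    then have bX: "bd X k" using bd_star_mult[OF XL] k by simp
    have "star T - star T * T * (star T * J) = star T * (1 - S * J)"
      by (simp add: S_def algebra_simps)
    also have "1 - S * J = rs \<epsilon> * J" using J(3) by (simp add: algebra_simps)
    finally have "star T - star T * T * (star T * J) = X"
      using T by (simp add: X_def rs_left_commute[of "star T"])
    then have "star T \<cdot> x - (star T * T) \<cdot> ((star T * J) \<cdot> x) = X \<cdot> x"
      by (metis endo_app(3,5))
    then show ?thesis using bX k(2) unfolding bd_def by (metis order_le_less_trans)
  qed
  then show "hclosure H (range (app (star T))) \<subseteq> hclosure H (range (app (star T * T)))"
    by (intro hclosure_subset) (auto simp: hclosure_def)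
qed

lemma orth_complemented_eq:
  assumes "x \<in> M" "y \<in> M" "x - y \<in> orth H M"
  shows "x = y"
  using assms ip_self_eq_0[of "x - y"] by (auto simp: orth_def ip_diff_left)

text \<open>Equality of inner products transfers the Cauchy estimate from
  \<open>A \<cdot> f n\<close> to \<open>B \<cdot> f n\<close>. Keeping the same \<open>f\<close> in
  both limits is what defines the relation \<open>G\<close> below.\<close>

lemma isometric_extension:
  assumes iso: "\<And>x y. \<langle>A \<cdot> x, A \<cdot> y\<rangle> = \<langle>B \<cdot> x, B \<cdot> y\<rangle>" and p: "p \<in> hclosure H (range (app A))"
  obtains u f where "conv (\<lambda>n. A \<cdot> f n) p" "conv (\<lambda>n. B \<cdot> f n) u"
proof -
  obtain f where f: "\<And>n. N (p - A \<cdot> f n) < (1/2) ^ n" using p hclosure_range_seq by blast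
  have AB: "N (A \<cdot> x) = N (B \<cdot> x)" for x by (simp add: hnorm_def iso)
  have step: "N (B \<cdot> f (Suc n) - B \<cdot> f n) \<le> 2 * (1/2) ^ n" for n
  proof -
    have "N (B \<cdot> f (Suc n) - B \<cdot> f n) = N (A \<cdot> f (Suc n) - A \<cdot> f n)"
      using AB[of "f (Suc n) - f n"] by simp
    also have "\<dots> \<le> N (A \<cdot> f (Suc n) - p) + N (p - A \<cdot> f n)" by (rule N_triangle_diff)
    also have "\<dots> \<le> (1/2) ^ Suc n + (1/2) ^ n"
      using f[of "Suc n"] f[of n] by (simp add: N_minus_commute[of _ p])
    also have "\<dots> \<le> 2 * (1/2) ^ n" by simp
    finally show ?thesis .
  qed
  have "summable (\<lambda>n. 2 * (1/2 :: real) ^ n)"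
    by (intro summable_mult summable_geometric) simp
  from series_conv[of _ "\<lambda>n. B \<cdot> f n", OF this step] obtain u where "conv (\<lambda>n. B \<cdot> f n) u" by metis
  moreover have "conv (\<lambda>n. A \<cdot> f n) p"
  proof (rule convI)
    show "N (A \<cdot> f n - p) \<le> (1/2) ^ n" for n using f[of n] by (simp add: N_minus_commute[of _ p])
    show "(\<lambda>n. (1/2 :: real) ^ n) \<longlonglongrightarrow> 0" by (rule LIMSEQ_power_zero) simp
  qed
  ultimately show ?thesis using that by blast
qed

text \<open>The partial isometry is the closure of the relation \<open>T \<cdot> x \<mapsto> B \<cdot> x\<close>; its adjoint is the
  closure of the inverse relation.\<close>

lemma polar_decomposition:
  assumes T: "sa T" and B: "B \<in> Lop" and TB: "T * T = star B * B"
    and c1: "orth_complemented H (hclosure H (range (app (star B))))"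
    and c2: "orth_complemented H (hclosure H (range (app B)))"
  obtains U where "U \<in> Lop" "U * T = B" "U * star U * U = U"
    "range (app (star U)) = hclosure H (range (app (star B)))"
    "range (app U) \<subseteq> hclosure H (range (app B))"
    "\<And>z. z - U \<cdot> star U \<cdot> z \<in> orth H (hclosure H (range (app B)))"
proof -
  define M1 where "M1 = hclosure H (range (app T))"
  define M2 where "M2 = hclosure H (range (app B))"
  \<comment> \<open>The closures for \<open>star B\<close> and for \<open>T\<close> both equal the
    closure of the range of \<open>star B * B = T * T\<close>; so the complement assumed for
    \<open>star B\<close> serves \<open>T\<close>.\<close>
  have M1: "hclosure H (range (app (star B))) = M1"
    using hclosure_range_star[OF B] hclosure_range_star[of T] T TB by (simp add: M1_def)
  have iso: "\<langle>T \<cdot> x, T \<cdot> y\<rangle> = \<langle>B \<cdot> x, B \<cdot> y\<rangle>" for x y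
  proof -
    have "\<langle>T \<cdot> x, T \<cdot> y\<rangle> = \<langle>x, (T * T) \<cdot> y\<rangle>" using T by (simp add: star_right)
    then show ?thesis using B by (simp add: TB star_right)
  qed
  define G where "G p u \<longleftrightarrow> (\<exists>f. conv (\<lambda>n. T \<cdot> f n) p \<and> conv (\<lambda>n. B \<cdot> f n) u)" for p u
  \<comment> \<open>Preservation of inner products makes the closed relation single-valued in both
    directions.\<close>
  have G_ip: "\<langle>p, p'\<rangle> = \<langle>u, u'\<rangle>" if "G p u" "G p' u'" for p u p' u'
  proof -
    obtain f g where fg: "conv (\<lambda>n. T \<cdot> f n) p" "conv (\<lambda>n. B \<cdot> f n) u"
      "conv (\<lambda>n. T \<cdot> g n) p'" "conv (\<lambda>n. B \<cdot> g n) u'" using \<open>G p u\<close> \<open>G p' u'\<close> by (auto simp: G_def)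
    show ?thesis
      using LIMSEQ_unique[OF conv_ip[OF fg(1,3)]] conv_ip[OF fg(2,4)] by (simp add: iso)
  qed
  have G_r: "u = u'" if "G p u" "G p u'" for p u u'
  proof -
    have "\<langle>u - u', u - u'\<rangle> = 0"
      unfolding ip_diff_left ip_diff_right using G_ip[OF that(1,1)] G_ip[OF that] G_ip[OF that(2,1)] G_ip[OF that(2,2)]
      by (metis diff_self)
    then show ?thesis using ip_self_eq_0[of "u - u'"] by simp
  qed
  have G_l: "p = p'" if "G p u" "G p' u" for p p' u
  proof -
    have "\<langle>p - p', p - p'\<rangle> = 0"
      unfolding ip_diff_left ip_diff_right using G_ip[OF that(1,1)] G_ip[OF that] G_ip[OF that(2,1)] G_ip[OF that(2,2)]
      by (metis diff_self)
    then show ?thesis using ip_self_eq_0[of "p - p'"] by simp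
  qed
  have G_M: "p \<in> M1 \<and> u \<in> M2" if "G p u" for p u
    using that conv_in_hclosure by (auto simp: G_def M1_def M2_def)
  have ex_r: "\<exists>u. G p u" if "p \<in> M1" for p
    using isometric_extension[OF iso, of p] that unfolding M1_def G_def by metis
  have ex_l: "\<exists>p. G p u" if "u \<in> M2" for u
    using isometric_extension[OF iso[symmetric], of u] that unfolding M2_def G_def by metis
  have TBG: "G (T \<cdot> x) (B \<cdot> x)" for x
    unfolding G_def by (rule exI[of _ "\<lambda>n. x"]) (simp add: conv_const)
  have "\<forall>x. \<exists>y\<in>M1. x - y \<in> orth H M1" "\<forall>x. \<exists>y\<in>M2. x - y \<in> orth H M2"
    using c1 c2 unfolding orth_complemented_def M1 M2_def[symmetric] by (metis add_diff_cancel_left')+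
  then obtain e1 e2 where e1: "\<And>x. e1 x \<in> M1" "\<And>x. x - e1 x \<in> orth H M1"
    and e2: "\<And>x. e2 x \<in> M2" "\<And>x. x - e2 x \<in> orth H M2" by metis
  have e1_id: "e1 x = x" if "x \<in> M1" for x using orth_complemented_eq[OF that e1] by simp
  have e2_id: "e2 x = x" if "x \<in> M2" for x using orth_complemented_eq[OF that e2] by simp
  obtain u v where u: "\<And>x. G (e1 x) (u x)" and v: "\<And>z. G (v z) (e2 z)"
    using ex_r[OF e1(1)] ex_l[OF e2(1)] by metis
  have ip_e1: "\<langle>x, p\<rangle> = \<langle>e1 x, p\<rangle>" if "p \<in> M1" for x p
  proof -
    have "\<langle>p, x - e1 x\<rangle> = 0" using e1(2)[of x] that by (auto simp: orth_def)
    then show ?thesis by (metis ip_diff_right ip_st right_minus_eq)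
  qed
  have ip_e2: "\<langle>p, z\<rangle> = \<langle>p, e2 z\<rangle>" if "p \<in> M2" for z p
    using e2(2)[of z] that by (auto simp: orth_def ip_diff_right)
  have "\<langle>u x, z\<rangle> = \<langle>x, v z\<rangle>" for x z
  proof -
    have "\<langle>u x, z\<rangle> = \<langle>u x, e2 z\<rangle>" using G_M[OF u] ip_e2 by blast
    also have "\<dots> = \<langle>e1 x, v z\<rangle>" using G_ip[OF u v] by simp
    also have "\<dots> = \<langle>x, v z\<rangle>" using G_M[OF v] ip_e1 by metis
    finally show ?thesis .
  qed
  \<comment> \<open>The choice functions \<open>u\<close> and \<open>v\<close> are not checked for
    linearity; being adjoint to each other suffices.\<close>
  then obtain U where U: "U \<in> Lop" "app U = u" "app (star U) = v" by (rule Lop_of_fun)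
  have vu: "v (u x) = e1 x" for x
    using G_l[OF v[of "u x"]] u[of x] e2_id G_M[OF u] by metis
  have uv: "u (v z) = e2 z" for z
    using G_r[OF u[of "v z"]] v[of z] e1_id G_M[OF v] by metis
  have "u (T \<cdot> x) = B \<cdot> x" for x
    using G_r[OF _ TBG[of x]] u[of "T \<cdot> x"] e1_id[of "T \<cdot> x"] G_M[OF TBG[of x]] by simp
  then have "U * T = B" by (intro endo_eqI) (simp add: U)
  moreover have "u (e1 x) = u x" for x
    using G_r[OF u[of "e1 x"]] u[of x] e1_id[OF e1(1)] by metis
  then have "U * star U * U = U" by (intro endo_eqI) (simp add: U vu)
  moreover have "range (app (star U)) = M1"
    unfolding U using G_M[OF v] vu e1_id by (metis (no_types) rangeI image_subsetI subsetI subset_antisym)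
  moreover have "range (app U) \<subseteq> M2" unfolding U using G_M[OF u] by auto
  moreover have "z - U \<cdot> star U \<cdot> z \<in> orth H M2" for z by (simp add: U uv e2)
  ultimately show ?thesis using that U(1) by (simp add: M1 M2_def)
qed

section \<open>Operators on complemented submodules\<close>

lemma LH_iff: "f \<in> LH H \<longleftrightarrow> (\<exists>T\<in>Lop. f = app T)"
proof
  assume "f \<in> LH H"
  then obtain g where "\<And>x y. \<langle>f x, y\<rangle> = \<langle>x, g y\<rangle>" by (auto simp: LH_def adjointable_between_def)
  then show "\<exists>T\<in>Lop. f = app T" by (rule Lop_of_fun) auto
next
  assume "\<exists>T\<in>Lop. f = app T"
  then show "f \<in> LH H" by (auto simp: LH_def adjointable_between_def star_right)
qed

lemma adjoint_on_eq:
  assumes z: "z \<in> M" "\<And>x. x \<in> M \<Longrightarrow> \<langle>f x, y\<rangle> = \<langle>x, z\<rangle>"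
  shows "adjoint_on H M K f y = z"
  unfolding adjoint_on_def
proof (rule the_equality)
  fix z' assume z': "z' \<in> M \<and> (\<forall>x\<in>M. \<langle>f x, y\<rangle> = \<langle>x, z'\<rangle>)"
  have "\<langle>z' - z, z'\<rangle> = \<langle>z' - z, z\<rangle>" unfolding ip_diff_left using z z' by simp
  then have "\<langle>z' - z, z' - z\<rangle> = 0" by (simp only: ip_diff_right diff_self)
  then show "z' = z" using ip_self_eq_0[of "z' - z"] by simp
qed (use z in auto)

lemma adj_app: "T \<in> Lop \<Longrightarrow> adj H (app T) = app (star T)"
  unfolding adj_def by (rule ext, rule adjoint_on_eq) (simp_all add: star_right)

lemma app_comp: "app S \<circ> app T = app (S * T)"
  by (auto simp: fun_eq_iff)

lemma app_one: "app 1 = id"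
  by (auto simp: fun_eq_iff)

text \<open>Penrose's uniqueness argument: for a second solution \<open>Y\<close>, taking adjoints
  of products of the self-adjoint idempotents gives \<open>X * D = Y * D\<close> and
  \<open>D * X = D * Y\<close>.\<close>

lemma mp_inv_app:
  assumes "D \<in> Lop" "X \<in> Lop" "D * X * D = D" "X * D * X = X" "sa (D * X)" "sa (X * D)"
  shows "mp_inv H (app D) = app X"
  unfolding mp_inv_def
proof (rule the_equality)
  show "app X \<in> LH H \<and> app D \<circ> app X \<circ> app D = app D \<and> app X \<circ> app D \<circ> app X = app X \<and>
    adj H (app D \<circ> app X) = app D \<circ> app X \<and> adj H (app X \<circ> app D) = app X \<circ> app D"
    unfolding LH_iff using assms by (auto simp: app_comp adj_app simp del: star_mult)
  fix f assume f: "f \<in> LH H \<and> app D \<circ> f \<circ> app D = app D \<and> f \<circ> app D \<circ> f = f \<and>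
    adj H (app D \<circ> f) = app D \<circ> f \<and> adj H (f \<circ> app D) = f \<circ> app D"
  then obtain Y where Y: "Y \<in> Lop" "f = app Y" by (auto simp: LH_iff)
  have DY: "D * Y * D = D" "Y * D * Y = Y" "star (D * Y) = D * Y" "star (Y * D) = Y * D"
    using f Y assms(1) by (simp_all add: app_comp adj_app app_inject del: star_mult)
  have DX: "star (D * X) = D * X" "star (X * D) = X * D" using assms by (simp_all del: star_mult)
  have "X * D = (X * D) * (Y * D)" using DY(1) by (metis mult.assoc)
  also have "\<dots> = star ((Y * D) * (X * D))"
    using DX(2) DY(4) star_mult[of "Y * D" "X * D"] assms(1,2) Y(1) by (simp del: star_mult)
  also have "(Y * D) * (X * D) = Y * D" using assms(3) by (metis mult.assoc)
  finally have 1: "X * D = Y * D" by (simp only: DY(4))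
  have "D * X = (D * Y) * (D * X)" using DY(1) by (metis mult.assoc)
  also have "\<dots> = star ((D * X) * (D * Y))"
    using DX(1) DY(3) star_mult[of "D * X" "D * Y"] assms(1,2) Y(1) by (simp del: star_mult)
  also have "(D * X) * (D * Y) = D * Y" using assms(3) by (metis mult.assoc)
  finally have 2: "D * X = D * Y" by (simp only: DY(3))
  have "X = Y" using 1 2 assms(4) DY(2) by (metis mult.assoc)
  then show "f = app X" by (simp add: Y)
qed

lemma inv_op_app:
  assumes "S \<in> Lop" "S * T = 1" "T * S = 1"
  shows "inv_op H (app T) = app S"
  unfolding inv_op_def
proof (rule the_equality)
  show "app S \<in> LH H \<and> app S \<circ> app T = id \<and> app T \<circ> app S = id"
    unfolding LH_iff using assms by (auto simp: app_comp app_one)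
  fix f assume f: "f \<in> LH H \<and> f \<circ> app T = id \<and> app T \<circ> f = id"
  then obtain Y where Y: "f = app Y" by (auto simp: LH_iff)
  then have "Y * T = 1" using f by (simp add: app_comp app_inject flip: app_one)
  then have "Y = S" using assms(3) by (metis mult.assoc mult_1_left mult_1_right)
  then show "f = app S" using Y by simp
qed

lemma proj_range: "P * P = P \<Longrightarrow> x \<in> range (app P) \<longleftrightarrow> P \<cdot> x = x"
proof
  assume P: "P * P = P" and "x \<in> range (app P)"
  then obtain y where "x = P \<cdot> y" by blast
  then show "P \<cdot> x = x" using arg_cong[OF P, of "\<lambda>T. T \<cdot> y"] by simp
qed (metis rangeI)

lemma proj_orth: "sa P \<Longrightarrow> x \<in> orth H (range (app P)) \<longleftrightarrow> P \<cdot> x = 0"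
proof -
  assume P: "sa P"
  have "x \<in> orth H (range (app P)) \<longleftrightarrow> (\<forall>y. \<langle>y, P \<cdot> x\<rangle> = 0)"
    using P by (auto simp: orth_def star_right)
  also have "\<dots> \<longleftrightarrow> P \<cdot> x = 0" using ip_self_eq_0 by auto
  finally show ?thesis .
qed

lemma adjointable_commute:
  assumes P: "P * P = P" and T: "sa T" "T * P = P * T" and f: "\<And>x. P \<cdot> x = x \<Longrightarrow> f x = T \<cdot> x"
  shows "adjointable_between H (range (app P)) (range (app P)) f"
proof -
  have maps: "T \<cdot> x \<in> range (app P)" if "x \<in> range (app P)" for x
    using that T(2) unfolding proj_range[OF P] by (metis endo_app(5))
  have f': "f x = T \<cdot> x" if "x \<in> range (app P)" for x
    using f that unfolding proj_range[OF P] by blast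
  have "f ` range (app P) \<subseteq> range (app P)"
  proof
    fix y assume "y \<in> f ` range (app P)"
    then obtain x where "x \<in> range (app P)" "y = f x" by blast
    then show "y \<in> range (app P)" using f' maps by simp
  qed
  moreover have "app T ` range (app P) \<subseteq> range (app P)" using maps by blast
  moreover have "\<langle>f x, y\<rangle> = \<langle>x, T \<cdot> y\<rangle>" if "x \<in> range (app P)" for x y
    unfolding f'[OF that] using T(1) by (simp add: star_right)
  ultimately show ?thesis unfolding adjointable_between_def by blast
qed

lemma positive_onI:
  assumes P: "sa P" "P * P = P" and T: "pos T" "T * P = P * T"
    and f: "\<And>x. P \<cdot> x = x \<Longrightarrow> f x = T \<cdot> x"
  shows "positive_on H (range (app P)) f"
proof -
  obtain X where X: "pos X" "X * X = T" "\<And>C. C \<in> Lop \<Longrightarrow> C * T = T * C \<Longrightarrow> C * X = X * C"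
    using pos_sqrt[OF T(1)] by blast
  have XP: "P * X = X * P" using X(3)[of P] P T by simp
  have maps: "P \<cdot> X \<cdot> x = X \<cdot> x" if "P \<cdot> x = x" for x
    using that XP by (metis endo_app(5))
  have "adjointable_between H (range (app P)) (range (app P)) f"
    using adjointable_commute[OF P(2) pos_sa[OF T(1)] T(2)] f by blast
  moreover have "adjointable_between H (range (app P)) (range (app P)) (app X)"
    using adjointable_commute[OF P(2) pos_sa[OF X(1)] XP[symmetric]] by blast
  moreover have "f x = adjoint_on H (range (app P)) (range (app P)) (app X) (X \<cdot> x)" if "x \<in> range (app P)" for x
  proof -
    have x: "P \<cdot> x = x" using that by (simp add: proj_range[OF P(2)])
    have "adjoint_on H (range (app P)) (range (app P)) (app X) (X \<cdot> x) = X \<cdot> X \<cdot> x"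
    proof (rule adjoint_on_eq)
      show "X \<cdot> X \<cdot> x \<in> range (app P)"
        unfolding proj_range[OF P(2)] by (rule maps[OF maps[OF x]])
      show "\<langle>X \<cdot> y, X \<cdot> x\<rangle> = \<langle>y, X \<cdot> X \<cdot> x\<rangle>" for y
        using star_right[OF pos_Lop[OF X(1)], of y "X \<cdot> x"] by (simp only: sa_star[OF pos_sa[OF X(1)]])
    qed
    also have "\<dots> = f x" using f[OF x] X(2) by (metis endo_app(5))
    finally show ?thesis by simp
  qed
  ultimately show ?thesis unfolding positive_on_def by blast
qed

text \<open>Composing the factor \<open>b\<close> and its adjoint with \<open>P\<close> extends them
  by zero off the range. Statements about the submodule thereby become statements about ring
  elements.\<close>

lemma positive_onE:
  assumes P: "sa P" "P * P = P" and f: "positive_on H (range (app P)) f"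
  obtains T where "pos T" "T * P = T" "P * T = T" "\<And>x. P \<cdot> x = x \<Longrightarrow> f x = T \<cdot> x"
proof -
  let ?M = "range (app P)"
  obtain b where adjb: "adjointable_between H ?M ?M b"
    and fb: "\<forall>x\<in>?M. f x = adjoint_on H ?M ?M b (b x)"
    using f unfolding positive_on_def by (elim conjE exE)
  then obtain s where b: "b ` ?M \<subseteq> ?M" "s ` ?M \<subseteq> ?M" "\<forall>x\<in>?M. \<forall>y\<in>?M. \<langle>b x, y\<rangle> = \<langle>x, s y\<rangle>"
    unfolding adjointable_between_def by (elim conjE exE)
  have b': "P \<cdot> b (P \<cdot> x) = b (P \<cdot> x)" and s': "P \<cdot> s (P \<cdot> x) = s (P \<cdot> x)" for x
    using b(1,2) proj_range[OF P(2)] by blast+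
  have Pip: "\<langle>P \<cdot> x, y\<rangle> = \<langle>x, P \<cdot> y\<rangle>" for x y using P by (simp add: star_right)
  have "\<langle>b (P \<cdot> x), y\<rangle> = \<langle>x, s (P \<cdot> y)\<rangle>" for x y
    using b(3)[rule_format, of "P \<cdot> x" "P \<cdot> y"] Pip[of "b (P \<cdot> x)" y] Pip[of x "s (P \<cdot> y)"] by (simp add: b' s')
  then obtain F where F: "F \<in> Lop" "app F = (\<lambda>x. b (P \<cdot> x))" "app (star F) = (\<lambda>y. s (P \<cdot> y))"
    by (rule Lop_of_fun)
  have PP: "P \<cdot> P \<cdot> x = P \<cdot> x" for x using P(2) by (metis endo_app(5))
  define T where "T = star F * F"
  have "pos T" unfolding T_def using F by (intro pos_star_mult)
  moreover have "P \<cdot> s (b (P \<cdot> x)) = s (b (P \<cdot> x))" for x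
    using s'[of "b (P \<cdot> x)"] by (simp add: b')
  then have "T * P = T" "P * T = T"
    by (intro endo_eqI; simp add: T_def F b' PP)+
  moreover have "f x = T \<cdot> x" if x: "P \<cdot> x = x" for x
  proof -
    have xM: "x \<in> ?M" using x proj_range[OF P(2)] by blast
    have "adjoint_on H ?M ?M b (b x) = s (b x)"
    proof (rule adjoint_on_eq)
      have bx: "b x \<in> ?M" using b(1) xM by blast
      then show "s (b x) \<in> ?M" using b(2) by blast
      show "\<langle>b y, b x\<rangle> = \<langle>y, s (b x)\<rangle>" if "y \<in> ?M" for y using b(3) bx that by blast
    qed
    also have "\<dots> = T \<cdot> x" using b'[of x] x by (simp add: T_def F)
    finally show ?thesis using bspec[OF fb xM] by simp
  qed
  ultimately show ?thesis using that by blast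
qed

text \<open>The root of \<open>T\<close> stays in the corner of \<open>P\<close>:
  \<open>S * (1 - P)\<close> has inner square \<open>(1 - P) * T * (1 - P) = 0\<close>. The value 0
  off the range matches the normalisation in \<open>sqrt_on\<close>, which makes the description
  unique as a function.\<close>

lemma sqrt_on_app:
  assumes P: "sa P" "P * P = P" and T: "pos T" "T * P = T" "P * T = T"
    and f: "\<And>x. P \<cdot> x = x \<Longrightarrow> f x = T \<cdot> x"
  obtains S where "pos S" "S * S = T" "S * P = S" "P * S = S"
    "\<And>C. C \<in> Lop \<Longrightarrow> C * T = T * C \<Longrightarrow> C * S = S * C"
    "sqrt_on H (range (app P)) f = (\<lambda>x. if P \<cdot> x = x then S \<cdot> x else 0)"
proof -
  obtain S where S: "pos S" "S * S = T" "\<And>C. C \<in> Lop \<Longrightarrow> C * T = T * C \<Longrightarrow> C * S = S * C"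
    using pos_sqrt[OF T(1)] by blast
  have PS: "P * S = S * P" using S(3)[of P] P T by simp
  have "star (S * (1 - P)) * (S * (1 - P)) = (1 - P) * ((S * S) * (1 - P))"
    using S(1) P(1) by (simp add: mult.assoc)
  also have "\<dots> = 0" using T(2) unfolding S(2) by (simp add: right_diff_distrib)
  finally have "S * (1 - P) = 0" using star_mult_self_eq_0[of "S * (1 - P)"] S(1) P(1) by simp
  then have SP: "S * P = S" by (simp add: right_diff_distrib)
  let ?s = "\<lambda>x. if P \<cdot> x = x then S \<cdot> x else 0"
  have PSx: "P \<cdot> S \<cdot> x = S \<cdot> x" for x using PS SP by (metis endo_app(5))
  have "sqrt_on H (range (app P)) f = ?s"
    unfolding sqrt_on_def proj_range[OF P(2)]
  proof (rule the_equality)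
    have "positive_on H (range (app P)) ?s"
      using positive_onI[OF P S(1) PS[symmetric], of ?s] by simp
    moreover have "?s (?s x) = f x" if "P \<cdot> x = x" for x
      using that PSx f[OF that] S(2) by (simp) (metis endo_app(5))
    ultimately show "positive_on H (range (app P)) ?s \<and> (\<forall>x\<in>range (app P). ?s (?s x) = f x) \<and>
        (\<forall>x. P \<cdot> x \<noteq> x \<longrightarrow> ?s x = 0)"
      using proj_range[OF P(2)] by auto
    fix g assume g: "positive_on H (range (app P)) g \<and> (\<forall>x\<in>range (app P). g (g x) = f x) \<and>
        (\<forall>x. P \<cdot> x \<noteq> x \<longrightarrow> g x = 0)"
    then have "positive_on H (range (app P)) g" by blast
    then obtain R where R: "pos R" "R * P = R" "P * R = R" "\<And>x. P \<cdot> x = x \<Longrightarrow> g x = R \<cdot> x"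
      using positive_onE[OF P] by blast
    have "R * R = T"
    proof (rule endo_eqI)
      fix x
      have PP: "P \<cdot> P \<cdot> x = P \<cdot> x" using P(2) by (metis endo_app(5))
      have RP: "R \<cdot> P \<cdot> y = R \<cdot> y" "P \<cdot> R \<cdot> y = R \<cdot> y" for y using R(2,3) by (metis endo_app(5))+
      have "(R * R) \<cdot> x = R \<cdot> R \<cdot> P \<cdot> x" using RP by simp
      also have "\<dots> = g (g (P \<cdot> x))" using R(4)[OF PP] R(4)[OF RP(2)] by simp
      also have "\<dots> = T \<cdot> P \<cdot> x" using g f[OF PP] by auto
      also have "\<dots> = T \<cdot> x" using T(2) by (metis endo_app(5))
      finally show "(R * R) \<cdot> x = T \<cdot> x" .
    qed
    then have "R = S" using pos_sqrt_unique[OF R(1) S(1)] S(2) by simp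
    then show "g = ?s" using g R(4) by auto
  qed
  then show ?thesis using that[of S] S SP PS by simp
qed

lemma sqrt_on_UNIV:
  assumes "pos S" "S * S = T"
  shows "sqrt_on H UNIV (app T) = app S"
proof -
  have T: "pos T" using pos_sq[of S] assms by auto
  obtain R where R: "pos R" "R * R = T" "sqrt_on H (range (app 1)) (app T) = (\<lambda>x. if 1 \<cdot> x = x then R \<cdot> x else 0)"
    using sqrt_on_app[of 1 T "app T", OF sa_1 mult_1_left T mult_1_right mult_1_left refl] by blast
  have "R = S" using pos_sqrt_unique R assms by auto
  then show ?thesis using R(3) by (simp add: app_one)
qed

text \<open>The root \<open>X\<close> of \<open>A\<close> also commutes with \<open>B\<close>, so
  the product is the conjugate \<open>X * B * X\<close>.\<close>

lemma pos_mult_commute: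
  assumes "pos A" "pos B" "A * B = B * A"
  shows "pos (A * B)"
proof -
  obtain X where X: "pos X" "X * X = A" "\<And>C. C \<in> Lop \<Longrightarrow> C * A = A * C \<Longrightarrow> C * X = X * C"
    using pos_sqrt[OF assms(1)] by blast
  have "B * X = X * B" using X(3)[of B] assms by simp
  then have "A * B = star X * B * X" using X(1,2) by (metis mult.assoc pos_sa sa_star)
  then show ?thesis using pos_conj[OF assms(2) pos_Lop[OF X(1)]] by simp
qed

end

section \<open>The matched projection\<close>

lemma mult_eq_assoc: "a * b = c \<Longrightarrow> a * (b * d) = c * d" for a :: "'a::semigroup_mult"
  by (simp flip: mult.assoc)

context cs_hilbert_mod
begin

text \<open>With \<open>M = Q + star Q - 1\<close> one has \<open>M\<^sup>2 = 1 + star (star Q - Q) * (star Q - Q)\<close>, the range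
  projection of \<open>Q\<close> is \<open>E = Q * M\<^sup>-\<^sup>1\<close>, and \<open>Q * star Q = E * M\<^sup>2\<close>. As \<open>M\<^sup>2\<close> commutes with \<open>E\<close>,
  the modulus of \<open>star Q\<close> is \<open>D = E * L\<close> with \<open>L = |M|\<close>, and its Moore--Penrose inverse is
  \<open>X = E * L\<^sup>-\<^sup>1\<close>.\<close>

lemma matched_proj_app:
  assumes Q: "Q \<in> Lop" and QQ: "Q * Q = Q"
  obtains P where "P \<in> Lop" "matched_proj H (app Q) = app P" "pos (P * Q * P - P)"
    "\<And>w. Q \<cdot> w = w \<Longrightarrow> star Q \<cdot> w = w \<Longrightarrow> P \<cdot> w = w"
proof -
  define q where "q = star Q"
  have q: "q \<in> Lop" "star q = Q" "star Q = q" using Q by (simp_all add: q_def)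
  have qq: "q * q = q" using arg_cong[OF QQ, of star] Q by (simp add: q_def)
  define M where "M = Q + q - 1"
  have M: "sa M" unfolding M_def by (rule saI) (simp_all add: Q q add.commute)
  define C where "C = star (q - Q) * (q - Q)"
  have C: "pos C" unfolding C_def using Q q by (intro pos_star_mult) simp
  have MC: "M * M = C + rs 1"
    using Q q by (simp add: C_def M_def algebra_simps QQ qq)
  obtain I2 where I2: "sa I2" "I2 * (M * M) = 1" "M * M * I2 = 1"
    and I2c: "\<And>S. S \<in> Lop \<Longrightarrow> S * C = C * S \<Longrightarrow> S * I2 = I2 * S"
    using pos_invertible[OF C, of 1] unfolding MC[symmetric] by auto
  have Ccomm: "S * C = C * S" if "S * (M * M) = M * M * S" for S
    using that unfolding MC by (simp add: distrib_left distrib_right)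
  have I2comm: "S * I2 = I2 * S" if "S \<in> Lop" "S * (M * M) = M * M * S" for S
    using I2c Ccomm that by blast
  define Mi where "Mi = M * I2"
  have MI: "M * I2 = I2 * M" using I2comm[of M] M by (simp add: mult.assoc)
  have Mi: "M * Mi = 1" "Mi * M = 1"
    using I2(2,3) by (simp_all add: Mi_def mult.assoc) (simp add: MI mult.assoc)
  have saMi: "sa Mi" unfolding Mi_def using M I2(1) MI by (rule sa_mult)
  have QM: "Q * M = Q * q" and Mq: "M * q = Q * q" and MQ: "M * Q = q * M"
    by (simp_all add: M_def algebra_simps QQ qq)
  define E where "E = Q * Mi"
  \<comment> \<open>Inverting \<open>M\<close> on both sides of \<open>M * Q = q * M\<close> gives
    \<open>Q * Mi = Mi * q\<close>, which is why \<open>E\<close> is self-adjoint.\<close>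
  have "Mi * (M * Q) * Mi = Mi * (q * M) * Mi" by (simp only: MQ)
  then have E': "E = Mi * q" by (simp add: E_def mult.assoc Mi mult_eq_assoc[OF Mi(2)])
  have saE: "sa E"
    by (rule saI) (use Q q saMi in \<open>simp_all add: E_def q\<close>, use E' E_def in simp)
  have EQ: "E * Q = Q"
  proof -
    have "E * Q = Mi * (q * Q)" by (simp add: E' mult.assoc)
    also have "q * Q = M * Q" by (simp add: M_def algebra_simps QQ)
    finally show ?thesis by (simp add: mult_eq_assoc[OF Mi(2)])
  qed
  have QE: "Q * E = E" by (simp add: E_def mult_eq_assoc[OF QQ])
  have EE: "E * E = E" using EQ by (simp add: E_def) (metis mult.assoc)
  have Eq: "E * q = E" using arg_cong[OF QE, of star] Q saE q by simp
  have EM2: "E * (M * M) = Q * q" by (simp add: E_def mult.assoc mult_eq_assoc[OF Mi(2)] QM)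
  have "M * M * E = Q * q" using arg_cong[OF EM2, of star] saE M Q q by simp
  then have M2E: "E * (M * M) = M * M * E" using EM2 by simp
  obtain L where L: "pos L" "L * L = M * M"
    and Lc: "\<And>S. S \<in> Lop \<Longrightarrow> S * (M * M) = M * M * S \<Longrightarrow> S * L = L * S"
    using pos_sqrt[OF pos_sq[OF M]] by blast
  have LE: "E * L = L * E" by (rule Lc[OF sa_Lop[OF saE] M2E])
  define K where "K = L * I2"
  have LM: "L * (M * M) = M * M * L" using L(2) by (metis mult.assoc)
  have LI: "L * I2 = I2 * L" using I2comm[OF pos_Lop[OF L(1)] LM] .
  have LK: "L * K = 1" using I2(3) L(2) by (simp add: K_def flip: mult.assoc)
  have KL: "K * L = 1" using I2(2) L(2) by (simp add: K_def LI mult.assoc)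
  have KE: "E * K = K * E"
    using LE I2comm[OF sa_Lop[OF saE] M2E] unfolding K_def by (metis mult.assoc)
  have saK: "sa K" unfolding K_def using L(1) I2(1) LI by (intro sa_mult) simp_all
  have posK: "pos K"
    using pos_conj[OF L(1), of K] saK by (simp add: LK mult.assoc)
  define D where "D = E * L"
  have D: "pos D"
  proof -
    have "star E * L * E = D" using saE by (simp add: D_def mult.assoc LE[symmetric] mult_eq_assoc[OF EE])
    then show ?thesis using pos_conj[OF L(1), of E] saE by simp
  qed
  have DD: "D * D = Q * q"
  proof -
    have "D * D = E * (L * E) * L" by (simp only: D_def mult.assoc)
    also have "\<dots> = E * (E * L) * L" by (simp only: LE)
    finally show ?thesis by (simp add: mult.assoc mult_eq_assoc[OF EE] L(2) EM2)
  qed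
  have ED: "E * D = D" by (simp add: D_def mult_eq_assoc[OF EE])
  have DE: "D * E = D" by (simp add: D_def mult.assoc LE[symmetric] mult_eq_assoc[OF EE])
  have QD: "Q * D = D" by (simp add: D_def mult_eq_assoc[OF QE])
  define X where "X = E * K"
  have DX: "D * X = E"
    by (simp add: D_def X_def mult.assoc LE[symmetric] mult_eq_assoc[OF LE[symmetric]] LK mult_eq_assoc[OF EE] EE)
  have XD: "X * D = E"
    by (simp add: D_def X_def mult.assoc mult_eq_assoc[OF KE[symmetric]] KL mult_eq_assoc[OF EE] EE)
  have EX: "E * X = X" by (simp add: X_def mult_eq_assoc[OF EE])
  have XL: "X \<in> Lop" using saE saK by (simp add: X_def)
  obtain R where R: "sa R" "R * (D + 1) = 1" "(D + 1) * R = 1"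
    and Rc: "\<And>S. S \<in> Lop \<Longrightarrow> S * D = D * S \<Longrightarrow> S * R = R * S"
    using pos_invertible[OF D, of 1] by auto
  have abs: "abs_op H (adj H (app Q)) = app D"
    using Q q sqrt_on_UNIV[OF D DD] by (simp add: abs_op_def adj_app app_comp)
  have mp: "mp_inv H (app D) = app X"
    using D XL saE DX XD EX ED by (intro mp_inv_app) simp_all
  have "app (D + 1) = (\<lambda>y. D \<cdot> y + y)" by (simp add: fun_eq_iff)
  then have iv: "inv_op H (\<lambda>y. D \<cdot> y + y) = app R"
    using inv_op_app[OF sa_Lop[OF R(1)] R(2,3)] by simp
  define W where "W = D + q"
  define W' where "W' = D + Q"
  define P where "P = rs (1/2) * (W * (X * (R * W')))"
  have PL: "P \<in> Lop" using D q Q XL R(1) by (simp add: P_def W_def W'_def)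
  have mP: "matched_proj H (app Q) = app P"
    unfolding matched_proj_def Let_def abs mp iv unfolding adj_app[OF Q]
    by (rule ext) (simp add: P_def W_def W'_def rs_app q sc_add)
  have RE: "E * R = R * E" using Rc[of E] saE by (simp add: ED DE)
  have KD: "K * D = D * K" by (simp add: D_def mult.assoc LK mult_eq_assoc[OF KE[symmetric]] KL)
  have KR: "K * R = R * K" using Rc[of K] saK KD by simp
  \<comment> \<open>The inner factor of \<open>P * Q * P\<close> contributes exactly
    \<open>(D + 1)\<^sup>2\<close>, which cancels both copies of the inverse
    \<open>R\<close>.\<close>
  have WQW: "W' * (Q * W) = D * ((D + 1) * (D + 1))"
    by (simp add: W_def W'_def algebra_simps QQ mult_eq_assoc[OF QQ] QD DD[symmetric] mult_eq_assoc[OF QD])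
  have XRX: "X * (R * (D * ((D + 1) * (D + 1)) * (X * R))) = X"
  proof -
    have c: "(D + 1) * X = X * (D + 1)" by (simp add: distrib_left distrib_right XD DX)
    have "D * ((D + 1) * (D + 1)) * (X * R) = D * ((D + 1) * (((D + 1) * X) * R))" by (simp only: mult.assoc)
    also have "\<dots> = D * ((D + 1) * ((X * (D + 1)) * R))" by (simp only: c)
    also have "\<dots> = D * (((D + 1) * X) * ((D + 1) * R))" by (simp only: mult.assoc)
    also have "\<dots> = D * ((X * (D + 1)) * 1)" by (simp only: c R(3))
    also have "\<dots> = D * X * (D + 1)" by (simp only: mult_1_right mult.assoc)
    finally have "X * (R * (D * ((D + 1) * (D + 1)) * (X * R))) = X * ((R * E) * (D + 1))"
      by (simp only: DX mult.assoc)
    also have "\<dots> = X * (E * (R * (D + 1)))" by (simp only: RE[symmetric] mult.assoc)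
    also have "\<dots> = X * E" by (simp only: R(2) mult_1_right)
    also have "\<dots> = X" by (simp add: X_def mult.assoc KE[symmetric] mult_eq_assoc[OF EE])
    finally show ?thesis .
  qed
  have PQP: "P * Q * P = rs (1/2 * (1/2)) * (W * (X * W'))"
  proof -
    let ?A = "W * (X * (R * W'))"
    have AL: "?A \<in> Lop" using D q Q XL R(1) by (simp add: W_def W'_def)
    have "P * Q * P = rs (1/2) * (?A * (Q * (rs (1/2) * ?A)))" by (simp only: P_def mult.assoc)
    also have "\<dots> = rs (1/2 * (1/2)) * (?A * (Q * ?A))"
      by (simp only: rs_left_commute[OF Q] rs_left_commute[OF AL] rs_rs)
    also have "?A * (Q * ?A) = W * (X * (R * ((W' * (Q * W)) * (X * R)))) * W'" by (simp only: mult.assoc)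
    also have "\<dots> = W * X * W'" by (simp only: WQW XRX)
    finally show ?thesis by (simp only: mult.assoc)
  qed
  \<comment> \<open>It remains to see that \<open>X - X * R - X * R = X * R * (D - 1)\<close> is
    positive. Rather than deriving \<open>E \<le> D\<close> from \<open>E \<le> D * D\<close>, the
    operator is written as \<open>K\<close> times \<open>star Z * Z\<close>, a product of commuting
    positive operators; \<open>Z\<close> is chosen so that
    \<open>Q * (1 - E) * q = D * D - E\<close> appears.\<close>
  define Z where "Z = (1 - E) * (q * R)"
  have ZL: "Z \<in> Lop" using saE q R(1) by (simp add: Z_def)
  have ZZ: "star Z * Z = R * (D * D - E) * R"
  proof -
    have "star Z = R * Q * (1 - E)" using saE q R(1) by (simp add: Z_def)
    then have "star Z * Z = R * (Q * ((1 - E) * (1 - E)) * q) * R" by (simp only: Z_def mult.assoc)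
    also have "(1 - E) * (1 - E) = 1 - E" by (simp add: algebra_simps EE)
    also have "Q * (1 - E) * q = D * D - E" by (simp add: algebra_simps DD mult_eq_assoc[OF QE] Eq QE)
    finally show ?thesis .
  qed
  have "K * (star Z * Z) = X - X * R - X * R"
  proof -
    have RD1: "R * D = 1 - R" using R(2) by (simp add: distrib_left algebra_simps)
    have "D * D - E = E * ((D - 1) * (D + 1))" by (simp add: algebra_simps mult_eq_assoc[OF ED])
    then have "K * (star Z * Z) = K * (R * E) * ((D - 1) * ((D + 1) * R))"
      by (simp only: ZZ mult.assoc)
    also have "\<dots> = K * E * (R * (D - 1))" by (simp only: R(3) mult_1_right RE[symmetric] mult.assoc)
    also have "\<dots> = X * (R * (D - 1))" by (simp only: X_def KE)
    also have "R * (D - 1) = 1 - R - R" by (simp only: right_diff_distrib RD1 mult_1_right)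
    finally show ?thesis by (simp add: right_diff_distrib)
  qed
  moreover have "K * (star Z * Z) = star Z * Z * K"
  proof -
    let ?V = "D * D - E"
    have KV: "K * ?V = ?V * K"
      by (simp add: right_diff_distrib left_diff_distrib KE mult_eq_assoc[OF KD] mult.assoc KD)
    have "K * (R * ?V * R) = (K * R) * ?V * R" by (simp only: mult.assoc)
    also have "\<dots> = R * (K * ?V) * R" by (simp only: KR mult.assoc)
    also have "\<dots> = R * ?V * (K * R)" by (simp only: KV mult.assoc)
    also have "\<dots> = R * ?V * R * K" by (simp only: KR mult.assoc)
    finally show ?thesis unfolding ZZ .
  qed
  ultimately have posKZ: "pos (X - X * R - X * R)"
    using pos_mult_commute[OF posK pos_star_mult[OF ZL]] by simp
  have "P * Q * P - P = rs (1/2 * (1/2)) * (star W' * (X - X * R - X * R) * W')"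
  proof -
    have "rs (1/2) = rs (1/2 * (1/2)) + rs (1/2 * (1/2))" using rs_add[of "1/2 * (1/2)" "1/2 * (1/2)"] by simp
    then have "P = rs (1/2 * (1/2)) * (W * (X * (R * W'))) + rs (1/2 * (1/2)) * (W * (X * (R * W')))"
      unfolding P_def by (simp only: distrib_right)
    moreover have "star W' = W" using D Q q by (simp add: W_def W'_def)
    ultimately show ?thesis unfolding PQP by (simp only: right_diff_distrib left_diff_distrib distrib_left distrib_right mult.assoc diff_diff_eq)
  qed
  then have posP: "pos (P * Q * P - P)"
    using pos_conj[OF posKZ, of W'] D Q by (simp add: pos_scale W'_def)
  have "P \<cdot> w = w" if w: "Q \<cdot> w = w" "star Q \<cdot> w = w" for w
  proof -
    have w': "q \<cdot> w = w" using w by (simp add: q_def)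
    have app_eq: "S \<cdot> T \<cdot> z = z" if "S * T = 1" for S T :: "'h endo" and z
      using arg_cong[OF that, of "\<lambda>T. T \<cdot> z"] by simp
    have Mw: "M \<cdot> w = w" by (simp add: M_def w(1) w')
    then have Miw: "Mi \<cdot> w = w" using app_eq[OF Mi(2), of w] by simp
    have Ew: "E \<cdot> w = w" by (simp add: E_def Miw w(1))
    have LLw: "L \<cdot> L \<cdot> w = w" using arg_cong[OF L(2), of "\<lambda>T. T \<cdot> w"] by (simp add: Mw)
    obtain J where "J * (L + 1) = 1" using pos_invertible[OF L(1), of 1] by auto
    \<comment> \<open>From \<open>L \<cdot> L \<cdot> w = w\<close> the vector
      \<open>L \<cdot> w - w\<close> is annihilated by \<open>L + 1\<close>, which is injective
      since \<open>L\<close> is positive.\<close>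
    then have "L \<cdot> w - w = J \<cdot> (L + 1) \<cdot> (L \<cdot> w - w)" using app_eq by metis
    also have "(L + 1) \<cdot> (L \<cdot> w - w) = 0" by (simp add: LLw)
    finally have Lw: "L \<cdot> w = w" by simp
    then have Kw: "K \<cdot> w = w" using app_eq[OF KL, of w] by simp
    have Dw: "D \<cdot> w = w" and Xw: "X \<cdot> w = w" by (simp_all add: D_def X_def Lw Kw Ew)
    have Rw: "R \<cdot> (w + w) = w" using app_eq[OF R(2), of w] by (simp add: Dw)
    have "P \<cdot> w = rs (1/2) \<cdot> (w + w)"
      using Rw by (simp add: P_def W_def W'_def Dw w(1) w' Xw flip: app_add)
    also have "\<dots> = w" using arg_cong[OF half_double[of 1], of "\<lambda>T. T \<cdot> w"] by simp
    finally show ?thesis .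
  qed
  then show ?thesis using that[OF PL mP posP] by blast
qed

subsection \<open>The block decomposition\<close>

text \<open>Continuity is used weakly: \<open>S\<close> is moved to the other side of the inner
  product before passing to the limit.\<close>

lemma hclosure_range_fixed:
  assumes "S \<in> Lop" "S * A = A" "p \<in> hclosure H (range (app A))"
  shows "S \<cdot> p = p"
proof (rule ip_eqI_left)
  fix y
  obtain f where f: "conv (\<lambda>n. A \<cdot> f n) p"
    using isometric_extension[of A A p] assms(3) by blast
  have "\<langle>A \<cdot> f n, star S \<cdot> y\<rangle> = \<langle>A \<cdot> f n, y\<rangle>" for n
    using arg_cong[OF assms(2), of "\<lambda>T. T \<cdot> f n"] star_right[OF assms(1), of "A \<cdot> f n" y] by simp
  then show "\<langle>S \<cdot> p, y\<rangle> = \<langle>p, y\<rangle>"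
    using LIMSEQ_unique[OF conv_ip[OF f conv_const, of "star S \<cdot> y"]] conv_ip[OF f conv_const, of y]
    by (simp add: star_right[OF assms(1)])
qed

lemma hclosure_range_null:
  assumes "Y \<in> Lop" "Y * A = 0" "p \<in> hclosure H (range (app A))"
  shows "Y \<cdot> p = 0"
  using hclosure_range_fixed[of "1 - Y" A p] assms by (simp add: left_diff_distrib)

text \<open>Of the explicit formula for the matched projection only \<open>pos\<close> and
  \<open>fixed\<close> enter. The latter excludes pairs such as \<open>P = 0\<close> with
  \<open>Q\<close> a nonzero projection, for which the block formula would give
  \<open>Q = 0\<close>.\<close>

lemma quasi_projection_decomposition:
  assumes P: "sa P" "P * P = P" and Q: "Q \<in> Lop" "Q * Q = Q"
    and qpp: "star Q = (P + P - 1) * Q * (P + P - 1)"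
    and pos: "pos (P * Q * P - P)"
    and fixed: "\<And>w. Q \<cdot> w = w \<Longrightarrow> star Q \<cdot> w = w \<Longrightarrow> P \<cdot> w = w"
    and c1: "orth_complemented H (hclosure H (range (app (P * Q * (1 - P)))))"
    and c2: "orth_complemented H (hclosure H (range (app ((1 - P) * Q * P))))"
  defines "H1 \<equiv> range (app P)"
  defines "H1p \<equiv> orth H H1"
  shows "\<exists>A U. positive_on H H1 A \<and> positive_on H H1 (\<lambda>x. A x - x) \<and>
      partial_isometry_on H H1 H1p U \<and>
      adjoint_on H H1 H1p U ` H1p = hclosure H ((\<lambda>x. A x - x) ` H1) \<and>
      (let sA = sqrt_on H H1 A; sAI = sqrt_on H H1 (\<lambda>x. A x - x);
           Us = adjoint_on H H1 H1p U in
       \<forall>a\<in>H1. \<forall>b\<in>H1p.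
         (P \<cdot> Q \<cdot> (a + b), Q \<cdot> (a + b) - P \<cdot> Q \<cdot> (a + b)) =
         (A a - sA (sAI (Us b)),
          U (sA (sAI a)) + U (Us b - A (Us b))))"
proof -
  define A where "A = P * Q * P"
  define B where "B = (1 - P) * Q * P"
  \<comment> \<open>This reflection is 1 on the range of \<open>P\<close> and -1 on its kernel, the
    source of the minus sign in \<open>starB\<close>.\<close>
  define F where "F = P + P - 1"
  have PP: "P * (P * S) = P * S" for S by (rule mult_eq_assoc[OF P(2)])
  have PF: "P * F = P" "F * P = P" "(1 - P) * F = - (1 - P)" "F * (1 - P) = - (1 - P)"
    using P(2) by (simp_all add: F_def algebra_simps)
  have AL: "A \<in> Lop" and BL: "B \<in> Lop" using P Q by (simp_all add: A_def B_def)
  have PA: "P * A = A" and AP: "A * P = A" by (simp_all add: A_def mult.assoc PP P(2))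
  have starB: "star B = - (P * Q * (1 - P))"
  proof -
    have "star B = P * star Q * (1 - P)" using P(1) Q(1) by (simp add: B_def mult.assoc)
    also have "\<dots> = (P * F) * Q * (F * (1 - P))" by (simp add: qpp F_def mult.assoc)
    finally show ?thesis by (simp only: PF(1,4) mult_minus_right)
  qed
  have BB: "star B * B = A * A - A"
  proof -
    have "star B * B = - (P * Q * ((1 - P) * (1 - P)) * Q * P)" unfolding starB unfolding B_def by (simp only: mult_minus_left mult.assoc)
    also have "(1 - P) * (1 - P) = 1 - P" using P(2) by (simp add: algebra_simps)
    finally show ?thesis by (simp add: A_def algebra_simps PP mult_eq_assoc[OF Q(2)])
  qed
  have posAP: "pos (A - P)" using pos by (simp add: A_def)
  have posP: "pos P" using pos_star_mult[of P] P by simp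
  have posA: "pos A" using pos_add[OF posAP posP] by simp
  have APP: "(A - P) * P = A - P" "P * (A - P) = A - P"
    using P(2) by (simp_all add: left_diff_distrib right_diff_distrib AP PA)
  have mem: "x \<in> H1 \<longleftrightarrow> P \<cdot> x = x" for x unfolding H1_def by (rule proj_range[OF P(2)])
  have memp: "x \<in> H1p \<longleftrightarrow> P \<cdot> x = 0" for x unfolding H1p_def H1_def by (rule proj_orth[OF P(1)])
  obtain sA where sA: "pos sA" "sA * sA = A" "sA * P = sA" "P * sA = sA"
    and sAc: "\<And>C. C \<in> Lop \<Longrightarrow> C * A = A * C \<Longrightarrow> C * sA = sA * C"
    and sqA: "sqrt_on H H1 (app A) = (\<lambda>x. if P \<cdot> x = x then sA \<cdot> x else 0)"
    using sqrt_on_app[OF P posA AP PA refl] unfolding H1_def by blast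
  have AI: "A \<cdot> x - x = (A - P) \<cdot> x" if "P \<cdot> x = x" for x by (simp add: that)
  obtain sI where sI: "pos sI" "sI * sI = A - P" "sI * P = sI" "P * sI = sI"
    and sIc: "\<And>C. C \<in> Lop \<Longrightarrow> C * (A - P) = (A - P) * C \<Longrightarrow> C * sI = sI * C"
    and sqI: "sqrt_on H H1 (\<lambda>x. A \<cdot> x - x) = (\<lambda>x. if P \<cdot> x = x then sI \<cdot> x else 0)"
    using sqrt_on_app[OF P posAP APP AI] unfolding H1_def by blast
  have AA: "A * (A - P) = (A - P) * A" by (simp add: left_diff_distrib right_diff_distrib AP PA)
  have AsI: "A * sI = sI * A" using sIc[OF AL AA] .
  have sIA: "sI * sA = sA * sI" using sAc[OF pos_Lop[OF sI(1)]] AsI by simp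
  have AsA: "A * sA = sA * A" using sAc[OF AL] by simp
  define T where "T = sA * sI"
  have saT: "sa T" unfolding T_def using sA(1) sI(1) sIA by (intro sa_mult) simp_all
  have TA: "T * A = A * T" unfolding T_def using AsI AsA by (metis mult.assoc)
  have "T * T = sA * (sI * sA) * sI" by (simp only: T_def mult.assoc)
  also have "\<dots> = (sA * sA) * (sI * sI)" by (simp only: sIA mult.assoc)
  finally have TT: "T * T = star B * B" by (simp add: sA(2) sI(2) BB right_diff_distrib AP)
  have rB: "range (app (P * Q * (1 - P))) = range (app (star B))"
  proof -
    have e: "star B \<cdot> x = (P * Q * (1 - P)) \<cdot> (- x)" for x
      unfolding starB endo_app(4) app_minus ..
    then have "(P * Q * (1 - P)) \<cdot> x = star B \<cdot> (- x)" for x unfolding e by (simp only: minus_minus)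
    then show ?thesis using e by (metis (no_types, lifting) image_subsetI rangeI subset_antisym)
  qed
  obtain U where U: "U \<in> Lop" "U * T = B" "U * star U * U = U"
    and rU: "range (app (star U)) = hclosure H (range (app (star B)))"
    and rU': "range (app U) \<subseteq> hclosure H (range (app B))"
    and Uo: "\<And>z. z - U \<cdot> star U \<cdot> z \<in> orth H (hclosure H (range (app B)))"
    using polar_decomposition[OF saT BL TT c1[unfolded rB] c2[folded B_def]] by blast
  have PsB: "P * star B = star B" using P(2) by (simp add: starB PP mult.assoc)
  have PsU: "P * star U = star U"
    by (rule endo_eqI) (use hclosure_range_fixed[OF sa_Lop[OF P(1)] PsB] rU in auto)
  have PB: "P * B = 0" using P(2) by (simp add: B_def left_diff_distrib right_diff_distrib PP mult.assoc)
  have PU: "P * U = 0"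
    by (rule endo_eqI) (use hclosure_range_null[OF sa_Lop[OF P(1)] PB] rU' in auto)
  have sUP: "star U * P = 0" using arg_cong[OF PU, of star] U(1) P(1) by simp
  have sU_H1: "star U \<cdot> z \<in> H1" for z unfolding mem using PsU by (metis endo_app(5))
  have U_H1p: "U \<cdot> x \<in> H1p" for x unfolding memp using PU by (metis endo_app(1,5))
  have adjU: "adjoint_on H H1 H1p (app U) y = star U \<cdot> y" for y
    by (rule adjoint_on_eq[OF sU_H1]) (simp add: star_right U(1))
  have "positive_on H H1 (app A)"
    unfolding H1_def by (rule positive_onI[OF P posA]) (simp_all add: AP PA)
  moreover have "positive_on H H1 (\<lambda>x. A \<cdot> x - x)"
    unfolding H1_def by (rule positive_onI[OF P posAP]) (simp_all add: APP)
  moreover have "partial_isometry_on H H1 H1p (app U)"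
  proof -
    have "adjointable_between H H1 H1p (app U)"
      unfolding adjointable_between_def
      using U_H1p sU_H1 star_right[OF U(1)] by (intro conjI exI[of _ "app (star U)"]) blast+
    moreover have "U \<cdot> star U \<cdot> U \<cdot> x = U \<cdot> x" for x using U(3) by (metis endo_app(5))
    ultimately show ?thesis by (simp add: partial_isometry_on_def adjU)
  qed
  moreover have "adjoint_on H H1 H1p (app U) ` H1p = hclosure H ((\<lambda>x. A \<cdot> x - x) ` H1)"
  proof -
    have "adjoint_on H H1 H1p (app U) ` H1p = app (star U) ` H1p" by (simp add: adjU)
    also have "\<dots> = range (app (star U))"
    proof -
      have "star U \<cdot> z \<in> app (star U) ` H1p" for z
      proof
        have "(star U * P) \<cdot> z = 0" by (simp only: sUP endo_app(1))
        then show "star U \<cdot> z = star U \<cdot> (z - P \<cdot> z)" by simp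
        have "(P * P) \<cdot> z = P \<cdot> z" by (simp only: P(2))
        then show "z - P \<cdot> z \<in> H1p" by (simp add: memp)
      qed
      then show ?thesis by blast
    qed
    also have "\<dots> = hclosure H (range (app (star B * B)))" using rU hclosure_range_star[OF BL] by simp
    also have "range (app (star B * B)) = (\<lambda>x. A \<cdot> x - x) ` H1"
    proof -
      have BBx: "(star B * B) \<cdot> x = A \<cdot> A \<cdot> x - A \<cdot> x" for x by (simp only: BB endo_app)
      have A_H1: "A \<cdot> x \<in> H1" for x unfolding mem using PA by (metis endo_app(5))
      \<comment> \<open>On \<open>H1\<close> the operator \<open>A\<close> agrees with
        \<open>A - P + 1\<close>, which is invertible with an inverse commuting with
        \<open>P\<close>. Hence \<open>A * A - A\<close> on the whole module and
        \<open>A - P\<close> on \<open>H1\<close> have the same range.\<close>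
      have A_surj: "\<exists>x. A \<cdot> x = y" if "y \<in> H1" for y
      proof -
        obtain J where J: "(A - P + 1) * J = 1" and Jc: "\<And>C. C \<in> Lop \<Longrightarrow> C * (A - P) = (A - P) * C \<Longrightarrow> C * J = J * C"
          using pos_invertible[OF posAP, of 1] by auto
        have "P * J = J * P" using Jc[of P] P(1) APP by simp
        then have "P \<cdot> J \<cdot> y = J \<cdot> y" using that unfolding mem by (metis endo_app(5))
        moreover have "(A - P + 1) \<cdot> J \<cdot> y = y" using arg_cong[OF J, of "\<lambda>S. S \<cdot> y"] by simp
        ultimately have "A \<cdot> J \<cdot> y = y" by simp
        then show ?thesis ..
      qed
      show ?thesis
      proof (intro subset_antisym subsetI)
        fix y assume "y \<in> range (app (star B * B))"
        then obtain x where "y = (star B * B) \<cdot> x" by blast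
        then show "y \<in> (\<lambda>x. A \<cdot> x - x) ` H1" unfolding BBx using A_H1 by blast
      next
        fix y assume "y \<in> (\<lambda>x. A \<cdot> x - x) ` H1"
        then obtain x where x: "x \<in> H1" "y = A \<cdot> x - x" by blast
        then obtain z where "A \<cdot> z = x" using A_surj by blast
        then have "y = (star B * B) \<cdot> z" unfolding BBx x by simp
        then show "y \<in> range (app (star B * B))" by blast
      qed
    qed
    finally show ?thesis .
  qed
  moreover have "\<forall>a\<in>H1. \<forall>b\<in>H1p.
         (P \<cdot> Q \<cdot> (a + b), Q \<cdot> (a + b) - P \<cdot> Q \<cdot> (a + b)) =
         (A \<cdot> a - sqrt_on H H1 (app A) (sqrt_on H H1 (\<lambda>x. A \<cdot> x - x) (adjoint_on H H1 H1p (app U) b)),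
          U \<cdot> sqrt_on H H1 (app A) (sqrt_on H H1 (\<lambda>x. A \<cdot> x - x) a) +
          U \<cdot> (adjoint_on H H1 H1p (app U) b - A \<cdot> adjoint_on H H1 H1p (app U) b))"
  proof (intro ballI)
    fix a b assume a: "a \<in> H1" and b: "b \<in> H1p"
    have Pa: "P \<cdot> a = a" and Pb: "P \<cdot> b = 0" using a b by (simp_all add: mem memp)
    have sq: "sqrt_on H H1 (app A) (sqrt_on H H1 (\<lambda>x. A \<cdot> x - x) x) = T \<cdot> x" if "x \<in> H1" for x
    proof -
      have "P \<cdot> sI \<cdot> x = sI \<cdot> x" using sI(4) by (metis endo_app(5))
      then show ?thesis using that unfolding sqA sqI mem by (simp add: T_def)
    qed
    have sB: "star B = T * star U" using arg_cong[OF U(2), of star] U(1) saT by simp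
    have PQb: "P \<cdot> Q \<cdot> b = - (T \<cdot> star U \<cdot> b)"
      using arg_cong[OF trans[OF starB[symmetric] sB], of "\<lambda>S. S \<cdot> b"] by (simp add: Pb)
        (metis minus_minus)
    have QPa: "Q \<cdot> a - P \<cdot> Q \<cdot> a = U \<cdot> T \<cdot> a"
      using arg_cong[OF U(2), of "\<lambda>S. S \<cdot> a"] by (simp add: B_def Pa)
    have PQa: "P \<cdot> Q \<cdot> a = A \<cdot> a" by (simp add: A_def Pa)
    define d where "d = (1 - P) * Q * (1 - P)"
    have dL: "d \<in> Lop" using P(1) Q(1) by (simp add: d_def)
    have dB: "d * B = B - B * A"
    proof -
      have "d * B = (1 - P) * Q * ((1 - P) * (1 - P)) * Q * P" by (simp only: d_def B_def mult.assoc)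
      also have "(1 - P) * (1 - P) = 1 - P" using P(2) by (simp add: algebra_simps)
      also have "(1 - P) * Q * (1 - P) * Q * P = B - B * A"
        by (simp add: B_def A_def algebra_simps PP mult_eq_assoc[OF Q(2)])
      finally show ?thesis .
    qed
    \<comment> \<open>The aim is \<open>d * U = U * (1 - A)\<close> on the range of
      \<open>star U\<close>. Multiplying \<open>Y\<close> by \<open>T\<close> turns \<open>U\<close>
      into \<open>B\<close>, where \<open>dB\<close> applies; the result passes to
      \<open>star B = T * star U\<close> and then to the closure of its range.\<close>
    define Y where "Y = d * U - U + U * A"
    have YL: "Y \<in> Lop" using dL U(1) AL by (simp add: Y_def)
    have "Y * T = d * B - B + B * A"
      unfolding Y_def left_diff_distrib distrib_right mult.assoc U(2) TA[symmetric]
      by (simp add: U(2) flip: mult.assoc)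
    then have "Y * T = 0" by (simp add: dB)
    then have "Y * star B = 0" by (simp add: sB flip: mult.assoc)
    then have "Y \<cdot> star U \<cdot> b = 0"
      using hclosure_range_null[OF YL] rU by blast
    then have dUU: "d \<cdot> U \<cdot> star U \<cdot> b = U \<cdot> (star U \<cdot> b - A \<cdot> star U \<cdot> b)"
      by (simp add: Y_def algebra_simps eq_neg_iff_add_eq_0)
    define z where "z = b - U \<cdot> star U \<cdot> b"
    have Pz: "P \<cdot> z = 0" using Pb U_H1p[of "star U \<cdot> b"] by (simp add: z_def memp)
    have "\<langle>B \<cdot> x, z\<rangle> = 0" for x
      using Uo[of b] hclosure_superset[of "range (app B)"] by (auto simp: orth_def z_def)
    then have "\<langle>x, star B \<cdot> z\<rangle> = 0" for x by (simp add: star_right[OF BL, symmetric])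
    then have "star B \<cdot> z = 0" using ip_self_eq_0 by blast
    then have PQz: "P \<cdot> Q \<cdot> z = 0" using Pz by (simp add: starB)
    \<comment> \<open>Since \<open>P \<cdot> Q \<cdot> z = 0\<close>, the reflection sends
      \<open>Q \<cdot> z\<close> to its negative; it occurs twice in \<open>star Q\<close>, so the
      signs cancel.\<close>
    have "star Q \<cdot> Q \<cdot> z = Q \<cdot> z"
    proof -
      have QQz: "Q \<cdot> Q \<cdot> z = Q \<cdot> z" using arg_cong[OF Q(2), of "\<lambda>S. S \<cdot> z"] by simp
      show ?thesis by (simp add: qpp PQz QQz)
    qed
    then have "P \<cdot> Q \<cdot> z = Q \<cdot> z" using fixed[of "Q \<cdot> z"] arg_cong[OF Q(2), of "\<lambda>S. S \<cdot> z"] by simp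
    then have "Q \<cdot> z = 0" using PQz by simp
    then have "d \<cdot> z = 0" using Pz by (simp add: d_def)
    then have "d \<cdot> b = U \<cdot> (star U \<cdot> b - A \<cdot> star U \<cdot> b)" using dUU by (simp add: z_def)
    moreover have "d \<cdot> b = Q \<cdot> b - P \<cdot> Q \<cdot> b" using Pb by (simp add: d_def)
    ultimately have Qb: "Q \<cdot> b - P \<cdot> Q \<cdot> b = U \<cdot> (star U \<cdot> b - A \<cdot> star U \<cdot> b)" by simp
    have "Q \<cdot> (a + b) - P \<cdot> Q \<cdot> (a + b) = (Q \<cdot> a - P \<cdot> Q \<cdot> a) + (Q \<cdot> b - P \<cdot> Q \<cdot> b)"
      by simp
    then have "Q \<cdot> (a + b) - P \<cdot> Q \<cdot> (a + b) = U \<cdot> T \<cdot> a + U \<cdot> (star U \<cdot> b - A \<cdot> star U \<cdot> b)"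
      by (simp only: QPa Qb)
    moreover have "P \<cdot> Q \<cdot> (a + b) = A \<cdot> a - T \<cdot> star U \<cdot> b" by (simp add: PQa PQb)
    ultimately show "(P \<cdot> Q \<cdot> (a + b), Q \<cdot> (a + b) - P \<cdot> Q \<cdot> (a + b)) =
         (A \<cdot> a - sqrt_on H H1 (app A) (sqrt_on H H1 (\<lambda>x. A \<cdot> x - x) (adjoint_on H H1 H1p (app U) b)),
          U \<cdot> sqrt_on H H1 (app A) (sqrt_on H H1 (\<lambda>x. A \<cdot> x - x) a) +
          U \<cdot> (adjoint_on H H1 H1p (app U) b - A \<cdot> adjoint_on H H1 H1p (app U) b))"
      by (simp only: adjU sq[OF a] sq[OF sU_H1])
  qed
  ultimately show ?thesis unfolding Let_def by blast
qed

end

theorem theorem3p11: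
  fixes H :: "('h::ab_group_add, 'a::{real_normed_algebra,banach}) hmod"
    and Q :: "'h \<Rightarrow> 'h"
  assumes "hilbert_module H"
    and "idempotent H Q"
    and "\<not> projection H Q"
    and "harmonious H (matched_proj H Q) Q"
  shows "let P = matched_proj H Q; H1 = range P; H1p = orth H H1 in
    \<exists>A U.
      positive_on H H1 A \<and> positive_on H H1 (\<lambda>x. A x - x) \<and>
      partial_isometry_on H H1 H1p U \<and>
      adjoint_on H H1 H1p U ` H1p = hclosure H ((\<lambda>x. A x - x) ` H1) \<and>
      (let sA = sqrt_on H H1 A; sAI = sqrt_on H H1 (\<lambda>x. A x - x);
           Us = adjoint_on H H1 H1p U in
       \<forall>a\<in>H1. \<forall>b\<in>H1p.
         (P (Q (a + b)), Q (a + b) - P (Q (a + b))) =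
         (A a - sA (sAI (Us b)),
          U (sA (sAI a)) + U (Us b - A (Us b))))"
proof -
  interpret hilbert_mod H using assms(1) by unfold_locales
  interpret cs_hilbert_mod H by (rule cs_hilbert_mod)
  obtain T where T: "T \<in> Lop" "Q = app T" using assms(2) by (auto simp: idempotent_def LH_iff)
  have TT: "T * T = T" using assms(2) by (simp add: idempotent_def T app_comp app_inject)
  obtain P where P: "P \<in> Lop" "matched_proj H Q = app P" "pos (P * T * P - P)"
    "\<And>w. T \<cdot> w = w \<Longrightarrow> star T \<cdot> w = w \<Longrightarrow> P \<cdot> w = w"
    using matched_proj_app[OF T(1) TT] unfolding T(2) by blast
  have h: "projection H (app P)" "adj H (app T) = (\<lambda>y. P \<cdot> y + P \<cdot> y - y) \<circ> app T \<circ> (\<lambda>y. P \<cdot> y + P \<cdot> y - y)"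
    "orth_complemented H (hclosure H (range (\<lambda>x. P \<cdot> T \<cdot> (x - P \<cdot> x))))"
    "orth_complemented H (hclosure H (range (\<lambda>x. T \<cdot> P \<cdot> x - P \<cdot> T \<cdot> P \<cdot> x)))"
    using assms(4) unfolding harmonious_def quasi_projection_pair_def P(2) unfolding T(2) by blast+
  \<comment> \<open>That \<open>P\<close> is a projection is read off from the quasi-projection pair
    inside harmony, not computed from the formula.\<close>
  have PP: "P * P = P" and starP: "star P = P"
    using h(1) P(1) by (simp_all add: projection_def idempotent_def app_comp app_inject adj_app)
  have F: "(\<lambda>y. P \<cdot> y + P \<cdot> y - y) = app (P + P - 1)" by (simp add: fun_eq_iff)
  have "star T = (P + P - 1) * T * (P + P - 1)"
    using h(2) T(1) unfolding F by (simp only: app_comp app_inject adj_app)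
  moreover have "(\<lambda>x. P \<cdot> T \<cdot> (x - P \<cdot> x)) = app (P * T * (1 - P))"
    "(\<lambda>x. T \<cdot> P \<cdot> x - P \<cdot> T \<cdot> P \<cdot> x) = app ((1 - P) * T * P)"
    by (simp_all add: fun_eq_iff)
  ultimately show ?thesis
    using quasi_projection_decomposition[OF saI[OF P(1) starP] PP T(1) TT _ P(3,4)] h(3,4)
    unfolding Let_def P(2) unfolding T(2) by simp
qed

end
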